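(* Let $\Omega$ be an open, bounded and convex subset of $\mathbb{R}^n$, and let $u\in C^{\infty}(\Omega)\cap C^0(\overline{\Omega})$, with $u>0$ in $\Omega$, be a solution of the boundary value problem $$ \begin{cases} -\Delta u+(x,\nabla u)=\lambda_\gamma(\Omega)\, u & \text{in } \Omega,\\ u=0 & \text{on } \partial\Omega . \end{cases} $$ Then the function $w=-\ln u$ is strongly convex in $\Omega$, i.e., the Hessian matrix $D^2 w(x)$ is positive definite for every $x\in\Omega$.
   Context: Here $(\cdot,\cdot)$ is the Euclidean inner product on $\mathbb{R}^n$, and $\gamma$ is the Gaussian probability measure on $\mathbb{R}^n$, $d\gamma(x)=(2\pi)^{-n/2}e^{-|x|^2/2}\,dx$. For an open bounded Lipschitz domain $\Omega\subset\mathbb{R}^n$ (in particular for an open bounded convex one), $\lambda_\gamma=\lambda_\gamma(\Omega)$ denotes the Gaussian principal frequency $$ \lambda_\gamma(\Omega)=\inf\left\{\frac{\int_\Omega|\nabla v|^2\,d\gamma}{\int_\Omega |v|^2\,d\gamma}\ :\ v\in W^{1,2}_0(\Omega,\gamma),\ v\not\equiv 0\right\}, $$ where $W^{1,2}_0(\Omega,\gamma)$ is the $\gamma$-weighted Sobolev space of functions with zero boundary values (the closure of $C_c^\infty(\Omega)$ in the norm $\left(\int_\Omega (|v|^2+|\nabla v|^2)\,d\gamma\right)^{1/2}$). The differential operator $Lu=\Delta u-(\nabla u,x)$ is the Ornstein-Uhlenbeck operator, so the equation reads $-Lu=\lambda_\gamma(\Omega)u$. *)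

theory Defs
  imports "HOL-Analysis.Analysis"
begin

definition partial_deriv :: "'n::finite \<Rightarrow> (real^'n \<Rightarrow> real) \<Rightarrow> real^'n \<Rightarrow> real" where
  "partial_deriv i f x = frechet_derivative f (at x) (axis i 1)"

definition gradient :: "(real^'n \<Rightarrow> real) \<Rightarrow> real^'n \<Rightarrow> real^'n::finite" where
  "gradient f x = (\<chi> i. partial_deriv i f x)"

definition hessian :: "(real^'n \<Rightarrow> real) \<Rightarrow> real^'n \<Rightarrow> real^'n^'n::finite" where
  "hessian f x = (\<chi> i j. partial_deriv i (partial_deriv j f) x)"

definition laplacian :: "(real^'n \<Rightarrow> real) \<Rightarrow> real^'n::finite \<Rightarrow> real" where
  "laplacian f x = (\<Sum>i\<in>UNIV. partial_deriv i (partial_deriv i f) x)"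

definition positive_definite :: "real^'n^'n::finite \<Rightarrow> bool" where
  "positive_definite A \<longleftrightarrow> transpose A = A \<and> (\<forall>v. v \<noteq> 0 \<longrightarrow> v \<bullet> (A *v v) > 0)"

(* Meant for open S: the derivatives are taken at x, not within S. *)
primrec Ck_on :: "nat \<Rightarrow> (real^'n) set \<Rightarrow> (real^'n::finite \<Rightarrow> real) \<Rightarrow> bool" where
  "Ck_on 0 S f \<longleftrightarrow> continuous_on S f"
| "Ck_on (Suc k) S f \<longleftrightarrow>
     (\<forall>x\<in>S. f differentiable (at x)) \<and> (\<forall>i. Ck_on k S (partial_deriv i f))"

definition smooth_on :: "(real^'n) set \<Rightarrow> (real^'n::finite \<Rightarrow> real) \<Rightarrow> bool" where
  "smooth_on S f \<longleftrightarrow> (\<forall>k. Ck_on k S f)"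

(* C_c^infinity(Om), each function extended by 0 outside Om *)
definition test_functions :: "(real^'n) set \<Rightarrow> (real^'n::finite \<Rightarrow> real) set" where
  "test_functions \<Omega> = {\<phi>. smooth_on UNIV \<phi> \<and>
     compact (closure {x. \<phi> x \<noteq> 0}) \<and> closure {x. \<phi> x \<noteq> 0} \<subseteq> \<Omega>}"

definition gauss_measure :: "(real^'n::finite) measure" where
  "gauss_measure = density lborel
     (\<lambda>x. ennreal ((2 * pi) powr (- (real CARD('n) / 2)) * exp (- (norm x)\<^sup>2 / 2)))"

definition L2_gauss :: "(real^'n::finite) set \<Rightarrow> (real^'n \<Rightarrow> 'b::euclidean_space) set" where
  "L2_gauss \<Omega> = {f. set_borel_measurable gauss_measure \<Omega> f \<and>
     set_integrable gauss_measure \<Omega> (\<lambda>x. (norm (f x))\<^sup>2)}"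

definition locally_integrable_on ::
    "(real^'n::finite) set \<Rightarrow> (real^'n \<Rightarrow> 'b::euclidean_space) \<Rightarrow> bool" where
  "locally_integrable_on \<Omega> f \<longleftrightarrow> (\<forall>K. compact K \<and> K \<subseteq> \<Omega> \<longrightarrow> set_integrable lborel K f)"

(* g is a distributional gradient of v on Om with respect to Lebesgue measure;
   it is determined by v only up to null sets, hence a relation. *)
definition weak_gradient ::
    "(real^'n::finite) set \<Rightarrow> (real^'n \<Rightarrow> real) \<Rightarrow> (real^'n \<Rightarrow> real^'n) \<Rightarrow> bool" where
  "weak_gradient \<Omega> v g \<longleftrightarrow>
     locally_integrable_on \<Omega> v \<and> locally_integrable_on \<Omega> g \<and>
     (\<forall>\<phi>\<in>test_functions \<Omega>. \<forall>i.
        (LINT x:\<Omega>|lborel. v x * partial_deriv i \<phi> x) = - (LINT x:\<Omega>|lborel. g x $ i * \<phi> x))"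

(* W^{1,2}(Om,gamma), as pairs of a function and a weak gradient of it *)
definition W12_gauss ::
    "(real^'n::finite) set \<Rightarrow> ((real^'n \<Rightarrow> real) \<times> (real^'n \<Rightarrow> real^'n)) set" where
  "W12_gauss \<Omega> = {(v, g). v \<in> L2_gauss \<Omega> \<and> g \<in> L2_gauss \<Omega> \<and> weak_gradient \<Omega> v g}"

definition W12_norm ::
    "(real^'n::finite) set \<Rightarrow> (real^'n \<Rightarrow> real) \<Rightarrow> (real^'n \<Rightarrow> real^'n) \<Rightarrow> real" where
  "W12_norm \<Omega> v g = sqrt (LINT x:\<Omega>|gauss_measure. (v x)\<^sup>2 + (norm (g x))\<^sup>2)"

(* W^{1,2}_0(Om,gamma): the closure of the test functions in W^{1,2}(Om,gamma) *)
definition W012_gauss ::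
    "(real^'n::finite) set \<Rightarrow> ((real^'n \<Rightarrow> real) \<times> (real^'n \<Rightarrow> real^'n)) set" where
  "W012_gauss \<Omega> = {(v, g). (v, g) \<in> W12_gauss \<Omega> \<and>
     (\<exists>\<phi>. (\<forall>k::nat. \<phi> k \<in> test_functions \<Omega>) \<and>
        (\<lambda>k. W12_norm \<Omega> (\<lambda>x. v x - \<phi> k x) (\<lambda>x. g x - gradient (\<phi> k) x)) \<longlonglongrightarrow> 0)}"

definition gauss_frequency :: "(real^'n::finite) set \<Rightarrow> real" where
  "gauss_frequency \<Omega> = Inf
     {(LINT x:\<Omega>|gauss_measure. (norm (g x))\<^sup>2) / (LINT x:\<Omega>|gauss_measure. (v x)\<^sup>2) | v g.
        (v, g) \<in> W012_gauss \<Omega> \<and> \<not> (AE x in gauss_measure. x \<in> \<Omega> \<longrightarrow> v x = 0)}"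

end

theory Submission
  imports Defs
begin

text \<open>
  With \<open>w = - ln u\<close> the equation reads \<open>\<Delta>w = \<lambda> + (x, \<nabla>w) + |\<nabla>w|\<^sup>2\<close>.

  Weak convexity. Extend \<open>u\<close> by zero and let \<open>v(m)\<close> be the supremum of \<open>sqrt (u(m + y) u(m - y))\<close> over \<open>y\<close>.
  The supremum is attained at points of \<open>\<Omega>\<close> where \<open>\<nabla>w\<close> has the same value \<open>p\<close>, and there the right hand side
  \<open>\<lambda> + (x, p) + |p|\<^sup>2\<close> is affine in \<open>x\<close>; hence \<open>v\<close> is a viscosity subsolution of the equation of \<open>u\<close>, with the same
  boundary values. A barrier that is a function of the (concave) distance to the boundary shows that \<open>v \<le> C u\<close>
  with equality somewhere in \<open>\<Omega>\<close>, so \<open>v = C u\<close> by the strong maximum principle. At a maximum point of \<open>u\<close>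
  one sees \<open>C = 1\<close>, that is, \<open>u\<close> is log-concave.

  Strong convexity. Differentiating twice in the direction of an eigenvector, the smallest eigenvalue \<open>\<mu>\<close> of
  \<open>D\<^sup>2w\<close> satisfies \<open>\<Delta>\<mu> - (x + 2 \<nabla>w, \<nabla>\<mu>) \<le> 2 \<mu> + 2 \<mu>\<^sup>2\<close> in the viscosity sense. Being nonnegative, it is
  positive everywhere or vanishes identically, and it is positive at the minimum of \<open>w - |x|\<^sup>2\<close>.
\<close>

section \<open>Second-order jets\<close>

text \<open>First and second derivative at 0, as a relation. Second-order information is only ever
  taken along lines \<open>x + t *\<^sub>R v\<close>, so a touching function just has to be twice
  differentiable, in this pointwise sense, along the axes through one point.\<close>

definition jet2 :: "(real \<Rightarrow> real) \<Rightarrow> real \<Rightarrow> real \<Rightarrow> bool" where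
  "jet2 f a b \<longleftrightarrow> (\<exists>g. (\<forall>\<^sub>F t in nhds 0. (f has_real_derivative g t) (at t)) \<and>
     g 0 = a \<and> (g has_real_derivative b) (at 0))"

lemma jet2I:
  assumes "\<And>t. (f has_real_derivative g t) (at t)" "g 0 = a" "(g has_real_derivative b) (at 0)"
  shows "jet2 f a b"
  unfolding jet2_def using assms by (intro exI[of _ g]) auto

lemma jet2_cong:
  assumes "jet2 f a b" "\<forall>\<^sub>F t in nhds 0. f t = f' t"
  shows "jet2 f' a b"
proof -
  obtain g where g: "\<forall>\<^sub>F t in nhds 0. (f has_real_derivative g t) (at t)" "g 0 = a"
    "(g has_real_derivative b) (at 0)"
    using assms(1) unfolding jet2_def by blast
  have "\<forall>\<^sub>F t in nhds 0. \<forall>\<^sub>F s in nhds t. f s = f' s"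
    using assms(2) by (simp add: eventually_eventually)
  then have "\<forall>\<^sub>F t in nhds 0. (f' has_real_derivative g t) (at t)"
    using g(1) by eventually_elim (metis DERIV_cong_ev)
  then show ?thesis unfolding jet2_def using g by blast
qed

lemma jet2_const: "jet2 (\<lambda>t. c) 0 0"
  by (rule jet2I[where g="\<lambda>_. 0"]) auto

lemma jet2_add:
  assumes "jet2 f a b" "jet2 f' a' b'"
  shows "jet2 (\<lambda>t. f t + f' t) (a + a') (b + b')"
proof -
  obtain g where g: "\<forall>\<^sub>F t in nhds 0. (f has_real_derivative g t) (at t)" "g 0 = a"
    "(g has_real_derivative b) (at 0)"
    using assms(1) unfolding jet2_def by blast
  obtain g' where g': "\<forall>\<^sub>F t in nhds 0. (f' has_real_derivative g' t) (at t)" "g' 0 = a'"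
    "(g' has_real_derivative b') (at 0)"
    using assms(2) unfolding jet2_def by blast
  have "\<forall>\<^sub>F t in nhds 0. ((\<lambda>t. f t + f' t) has_real_derivative g t + g' t) (at t)"
    using g(1) g'(1) by eventually_elim (rule DERIV_add)
  then show ?thesis unfolding jet2_def using g g'
    by (intro exI[of _ "\<lambda>t. g t + g' t"]) (auto intro: DERIV_add)
qed

lemma jet2_cmult:
  assumes "jet2 f a b"
  shows "jet2 (\<lambda>t. c * f t) (c * a) (c * b)"
proof -
  obtain g where g: "\<forall>\<^sub>F t in nhds 0. (f has_real_derivative g t) (at t)" "g 0 = a"
    "(g has_real_derivative b) (at 0)"
    using assms(1) unfolding jet2_def by blast
  have "\<forall>\<^sub>F t in nhds 0. ((\<lambda>t. c * f t) has_real_derivative c * g t) (at t)"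
    using g(1) by eventually_elim (rule DERIV_cmult)
  then show ?thesis unfolding jet2_def using g
    by (intro exI[of _ "\<lambda>t. c * g t"]) (auto intro: DERIV_cmult)
qed

lemma jet2_diff:
  assumes "jet2 f a b" "jet2 f' a' b'"
  shows "jet2 (\<lambda>t. f t - f' t) (a - a') (b - b')"
  using jet2_add[OF assms(1) jet2_cmult[OF assms(2), of "-1"]] by simp

lemma jet2_sum:
  assumes "\<And>k. k \<in> A \<Longrightarrow> jet2 (f k) (a k) (b k)"
  shows "jet2 (\<lambda>t. \<Sum>k\<in>A. f k t) (\<Sum>k\<in>A. a k) (\<Sum>k\<in>A. b k)"
  using assms by (induction A rule: infinite_finite_induct) (auto intro: jet2_const jet2_add)

lemma jet2_exp:
  assumes "jet2 f a b"
  shows "jet2 (\<lambda>t. exp (f t)) (exp (f 0) * a) (exp (f 0) * (a\<^sup>2 + b))"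
proof -
  obtain g where g: "\<forall>\<^sub>F t in nhds 0. (f has_real_derivative g t) (at t)" "g 0 = a"
    "(g has_real_derivative b) (at 0)"
    using assms(1) unfolding jet2_def by blast
  have "\<forall>\<^sub>F t in nhds 0. ((\<lambda>t. exp (f t)) has_real_derivative exp (f t) * g t) (at t)"
    using g(1) by eventually_elim (auto intro!: derivative_eq_intros)
  moreover have "(f has_real_derivative g 0) (at 0)"
    using g(1) by (rule eventually_nhds_x_imp_x)
  then have "((\<lambda>t. exp (f t) * g t) has_real_derivative exp (f 0) * (a\<^sup>2 + b)) (at 0)"
    using g by (auto intro!: derivative_eq_intros simp: algebra_simps power2_eq_square)
  ultimately show ?thesis unfolding jet2_def using g
    by (intro exI[of _ "\<lambda>t. exp (f t) * g t"]) auto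
qed

text \<open>For two points that move in opposite directions: in a sum with a reflected function the
  first derivatives are subtracted and the second ones added.\<close>

lemma jet2_reflect:
  assumes "jet2 f a b"
  shows "jet2 (\<lambda>t. f (- t)) (- a) b"
proof -
  obtain g where g: "\<forall>\<^sub>F t in nhds 0. (f has_real_derivative g t) (at t)" "g 0 = a"
    "(g has_real_derivative b) (at 0)"
    using assms(1) unfolding jet2_def by blast
  have "filterlim uminus (nhds 0) (nhds (0::real))"
    using tendsto_minus[OF tendsto_ident_at, of "0::real" UNIV]
    by (metis filterlim_def filtermap_nhds_minus minus_zero order_refl)
  then have "\<forall>\<^sub>F t in nhds 0. (f has_real_derivative g (- t)) (at (- t))"
    using g(1) unfolding filterlim_iff by (elim allE) (erule mp)
  then have "\<forall>\<^sub>F t in nhds 0. ((\<lambda>t. f (- t)) has_real_derivative - g (- t)) (at t)"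
    by eventually_elim (simp add: DERIV_mirror)
  moreover have "((\<lambda>t. - g (- t)) has_real_derivative b) (at 0)"
    using DERIV_minus[of "\<lambda>t. g (- t)" "- b" 0 UNIV] g(3) DERIV_mirror[of g b 0] by auto
  ultimately show ?thesis unfolding jet2_def using g
    by (intro exI[of _ "\<lambda>t. - g (- t)"]) auto
qed

text \<open>The second-derivative test, to which each maximum principle below is reduced, axis by
  axis. If \<open>b\<close> were negative, \<open>g\<close> would be negative just to the right of 0
  and \<open>f\<close> would fall below \<open>f 0\<close> there.\<close>

lemma jet2_local_min:
  assumes "jet2 f a b" "\<forall>\<^sub>F t in nhds 0. f 0 \<le> f t"
  shows "a = 0 \<and> b \<ge> 0"
proof -
  obtain g where g: "\<forall>\<^sub>F t in nhds 0. (f has_real_derivative g t) (at t)" "g 0 = a"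
    "(g has_real_derivative b) (at 0)"
    using assms(1) unfolding jet2_def by blast
  obtain e where e: "e > 0" "\<And>t. \<bar>t\<bar> < e \<Longrightarrow> (f has_real_derivative g t) (at t)"
      "\<And>t. \<bar>t\<bar> < e \<Longrightarrow> f 0 \<le> f t"
    using eventually_conj[OF g(1) assms(2)] unfolding eventually_nhds_metric dist_real_def by auto
  have a: "a = 0"
    using DERIV_local_min[of f "g 0" 0 e] e g(2) by auto
  have "b \<ge> 0"
  proof (rule ccontr)
    assume "\<not> b \<ge> 0"
    then obtain d where d: "d > 0" "\<And>h. 0 < h \<Longrightarrow> h < d \<Longrightarrow> g h < g 0"
      using DERIV_neg_dec_right[OF g(3)] by auto
    define s where "s = min (d/2) (e/2)"
    have s: "0 < s" "s < d" "s < e" using d e by (auto simp: s_def)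
    have "f s < f 0"
    proof (rule DERIV_neg_imp_decreasing_open[OF s(1)])
      fix x assume "0 < x" "x < s"
      then show "\<exists>y. DERIV f x :> y \<and> y < 0"
        using d(2)[of x] e(2)[of x] s a g(2) by (intro exI[of _ "g x"]) auto
    next
      show "continuous_on {0..s} f"
        using s e(2) by (intro DERIV_atLeastAtMost_imp_continuous_on) (metis abs_of_nonneg order.strict_trans1)
    qed
    then show False using e(3)[of s] s by auto
  qed
  then show ?thesis using a by simp
qed

section \<open>Infima over a compact parameter set\<close>

lemma compact_INF_attained:
  fixes g :: "'a::topological_space \<Rightarrow> real"
  assumes "compact K" "K \<noteq> {}" "continuous_on K g"
  shows "\<exists>y\<in>K. (INF z\<in>K. g z) = g y \<and> (\<forall>z\<in>K. g y \<le> g z)"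
proof -
  obtain y where y: "y \<in> K" "\<forall>z\<in>K. g y \<le> g z"
    using continuous_attains_inf[OF assms] by blast
  then have "(INF y\<in>K. g y) = g y"
    by (intro cInf_eq_minimum) auto
  then show ?thesis using y by blast
qed

text \<open>By compactness of \<open>K\<close>, \<open>G z\<close> is close to \<open>G x\<close>
  uniformly in the parameter once \<open>z\<close> is near \<open>x\<close>. Comparing each infimum
  with the value at the other one's minimizer then bounds their difference.\<close>

lemma continuous_on_INF_compact:
  fixes G :: "'a::metric_space \<Rightarrow> 'b::metric_space \<Rightarrow> real"
  assumes K: "compact K" "K \<noteq> {}" and cont: "continuous_on (S \<times> K) (\<lambda>(x, y). G x y)"
  shows "continuous_on S (\<lambda>x. INF y\<in>K. G x y)"
  unfolding continuous_on_iff
proof (intro ballI allI impI)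
  fix x and e :: real assume x: "x \<in> S" and e: "e > 0"
  have att: "\<exists>y\<in>K. (INF y\<in>K. G z y) = G z y \<and> (\<forall>y'\<in>K. G z y \<le> G z y')" if "z \<in> S" for z
  proof -
    have "continuous_on K (\<lambda>y. (\<lambda>(x, y). G x y) (z, y))"
      by (rule continuous_on_compose2[OF cont]) (use that in \<open>auto intro: continuous_on_Pair\<close>)
    then have "continuous_on K (G z)" by simp
    then show ?thesis by (rule compact_INF_attained[OF K])
  qed
  obtain X where X: "x \<in> X" "open X"
    "\<forall>z\<in>X \<inter> S. \<forall>y\<in>K. dist ((\<lambda>(x, y). G x y) (z, y)) ((\<lambda>(x, y). G x y) (x, y)) \<le> e / 2"
    by (rule continuous_on_prod_compactE[OF cont K(1) x half_gt_zero[OF e]]) (rule that)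
  obtain d where d: "d > 0" "ball x d \<subseteq> X" using X openE by blast
  show "\<exists>d>0. \<forall>x'\<in>S. dist x' x < d \<longrightarrow> dist (INF y\<in>K. G x' y) (INF y\<in>K. G x y) < e"
  proof (intro exI[of _ d] conjI ballI impI d(1))
    fix z assume z: "z \<in> S" "dist z x < d"
    then have zX: "z \<in> X \<inter> S" using d(2) by (auto simp: dist_commute)
    have cl: "\<bar>G z y - G x y\<bar> \<le> e / 2" if "y \<in> K" for y
      using bspec[OF bspec[OF X(3) zX] that] by (simp only: split_conv dist_real_def)
    obtain y1 where y1: "y1 \<in> K" "(INF y\<in>K. G z y) = G z y1" "\<forall>y'\<in>K. G z y1 \<le> G z y'"
      using att[OF z(1)] by blast
    obtain y2 where y2: "y2 \<in> K" "(INF y\<in>K. G x y) = G x y2" "\<forall>y'\<in>K. G x y2 \<le> G x y'"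
      using att[OF x] by blast
    have "G z y1 \<le> G z y2" "G x y2 \<le> G x y1" using y1 y2 by auto
    then show "dist (INF y\<in>K. G z y) (INF y\<in>K. G x y) < e"
      using cl[OF y1(1)] cl[OF y2(1)] e unfolding dist_real_def y1(2) y2(2) by linarith
  qed
qed

section \<open>Strong minimum principle for touched functions\<close>

lemma jet2_quadratic: "jet2 (\<lambda>t. k + l * t + m * t\<^sup>2) l (2 * m)"
  by (rule jet2I[where g="\<lambda>t. l + 2 * m * t"]) (auto intro!: derivative_eq_intros)

lemma eventually_nhds_line:
  fixes x v :: "'a::real_normed_vector"
  assumes "\<forall>\<^sub>F y in nhds x. P y"
  shows "\<forall>\<^sub>F t in nhds 0. P (x + t *\<^sub>R v)"
proof -
  have "((\<lambda>t. x + t *\<^sub>R v) \<longlongrightarrow> x + 0 *\<^sub>R v) (nhds 0)"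
    by (intro tendsto_intros) (simp add: filterlim_ident)
  then show ?thesis
    using assms unfolding filterlim_iff by simp
qed

lemma norm_line_sq:
  fixes x q :: "real^'n::finite"
  shows "(norm (x + t *\<^sub>R axis i 1 - q))\<^sup>2 = (norm (x - q))\<^sup>2 + 2 * (x - q) $ i * t + 1 * t\<^sup>2"
proof -
  have "(norm (x + t *\<^sub>R axis i 1 - q))\<^sup>2 = (norm ((x - q) + t *\<^sub>R axis i 1))\<^sup>2"
    by (simp add: algebra_simps)
  also have "\<dots> = (norm (x - q))\<^sup>2 + 2 * t * ((x - q) \<bullet> axis i 1) + t\<^sup>2 * (axis i 1 \<bullet> (axis i 1 :: real^'n))"
    unfolding power2_norm_eq_inner inner_add_left inner_add_right
    by (simp add: inner_commute power2_eq_square)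
  finally show ?thesis by (simp add: inner_axis)
qed

text \<open>Hopf's configuration. By connectedness the zero set is not open, so some zero
  \<open>z\<close> has points \<open>p\<close> with \<open>f p \<noteq> 0\<close> arbitrarily near;
  the zero \<open>y\<close> closest to \<open>p\<close> is touched by a ball free of zeros.\<close>

lemma zero_set_touching_ball:
  fixes f :: "'a::euclidean_space \<Rightarrow> real"
  assumes "open S" "connected S" "continuous_on S f" and nonneg: "\<And>x. x \<in> S \<Longrightarrow> f x \<ge> 0"
    and "x0 \<in> S" "f x0 = 0" "x1 \<in> S" "f x1 \<noteq> 0"
  obtains y q R r where "R > 0" "r > 0" "r \<le> R / 2" "dist q y = R" "cball y r \<subseteq> S" "f y = 0"
    "\<And>x. \<lbrakk>x \<in> cball y r; x \<in> cball q R; x \<noteq> y\<rbrakk> \<Longrightarrow> f x > 0"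
proof -
  define A where "A = {x \<in> S. f x = 0}"
  define B where "B = {x \<in> S. f x \<noteq> 0}"
  have "open B"
  proof -
    have "B = S \<inter> f -` (- {0})" by (auto simp: B_def)
    then show ?thesis using continuous_open_preimage[OF assms(3,1), of "- {0}"] by auto
  qed
  have "\<not> open A"
  proof
    assume "open A"
    moreover have "A \<inter> B \<inter> S = {}" "S \<subseteq> A \<union> B" "A \<inter> S \<noteq> {}" "B \<inter> S \<noteq> {}"
      using assms by (auto simp: A_def B_def)
    ultimately show False using \<open>open B\<close> assms(2) unfolding connected_def by blast
  qed
  then obtain z where z: "z \<in> A" "\<And>e. e > 0 \<Longrightarrow> \<not> ball z e \<subseteq> A"
    unfolding open_contains_ball by blast
  then have "z \<in> S" by (simp add: A_def)
  then obtain e' where e': "e' > 0" "cball z e' \<subseteq> S" using assms(1) open_contains_cball by blast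
  define e where "e = e' / 4"
  have e: "e > 0" "cball z (4 * e) \<subseteq> S" using e' by (auto simp: e_def)
  obtain p where p: "p \<in> ball z e" "p \<notin> A" using z(2)[OF e(1)] by blast
  have "p \<in> S" using p(1) e by (auto simp: subset_iff)
  \<comment> \<open>Radius \<open>2 * e\<close> suffices: a point closer to \<open>p\<close> than
    \<open>y\<close> is has distance less than \<open>e\<close> from \<open>p\<close>, hence less
    than \<open>2 * e\<close> from \<open>z\<close>. So it would lie in \<open>T\<close> if it were
    a zero.\<close>
  define T where "T = {x \<in> cball z (2 * e). f x = 0}"
  have "continuous_on (cball z (2 * e)) f"
    using continuous_on_subset[OF assms(3)] e by (auto simp: subset_iff)
  then have "closed T" unfolding T_def by (rule continuous_closed_preimage_constant) simp
  moreover have zT: "z \<in> T" using z e by (auto simp: T_def A_def)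
  ultimately obtain y where y: "y \<in> T" "\<And>x. x \<in> T \<Longrightarrow> dist p y \<le> dist p x"
    using distance_attains_inf[of T p] by blast
  \<comment> \<open>\<open>ball p (dist p y)\<close> avoids the zeros of \<open>f\<close>; the half-size ball touching it at \<open>y\<close> has
      no other zero in its closure.\<close>
  define R where "R = dist p y / 2"
  define q where "q = (1/2) *\<^sub>R (p + y)"
  have "p \<noteq> y" using y(1) p(2) \<open>p \<in> S\<close> by (auto simp: T_def A_def)
  then have R: "R > 0" by (simp add: R_def)
  have Re: "2 * R < e" using y(2)[OF zT] p(1) by (simp add: R_def dist_commute)
  have zy: "dist z y \<le> 2 * e" using y(1) by (simp add: T_def)
  have "q - y = (1/2) *\<^sub>R (p - y)" by (simp add: q_def algebra_simps flip: scaleR_add_left)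
  then have qy: "dist q y = R" by (simp add: dist_norm R_def)
  have sub: "cball y (R/2) \<subseteq> S"
  proof
    fix x assume "x \<in> cball y (R/2)"
    then have "dist z x \<le> 4 * e" using zy Re R dist_triangle[of z x y] by auto
    then show "x \<in> S" using e(2) by auto
  qed
  have pos: "f x > 0" if x: "x \<in> cball y (R/2)" "x \<in> cball q R" "x \<noteq> y" for x
  proof -
    have "dist p x < dist p y"
    proof (rule ccontr)
      \<comment> \<open>The segment from \<open>p\<close> to \<open>y\<close> is a diameter of
        \<open>cball q R\<close>, so \<open>x\<close> in that ball means
        \<open>(norm (x - p))\<^sup>2 \<le> (x - p) \<bullet> (y - p)\<close>. If \<open>x\<close>
        is no closer to \<open>p\<close> than \<open>y\<close>, expanding the square of
        \<open>x - y\<close> forces \<open>x = y\<close>.\<close>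
      assume "\<not> dist p x < dist p y"
      then have 1: "(norm (x - p))\<^sup>2 \<ge> (norm (y - p))\<^sup>2"
        by (intro power_mono) (auto simp: dist_norm norm_minus_commute)
      have "(norm (x - q))\<^sup>2 \<le> R\<^sup>2" using x(2) by (intro power_mono) (auto simp: dist_norm norm_minus_commute)
      moreover have "x - q = (x - p) - (1/2) *\<^sub>R (y - p)"
        by (simp add: q_def algebra_simps flip: scaleR_add_left)
      moreover have "R\<^sup>2 = (norm (y - p))\<^sup>2 / 4"
        by (simp add: R_def dist_norm norm_minus_commute power_divide)
      ultimately have 2: "(norm ((x - p) - (1/2) *\<^sub>R (y - p)))\<^sup>2 \<le> (norm (y - p))\<^sup>2 / 4" by simp
      then have "(norm (x - p))\<^sup>2 \<le> (x - p) \<bullet> (y - p)"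
        unfolding power2_norm_eq_inner by (simp add: algebra_simps inner_commute)
      then have "(norm ((x - p) - (y - p)))\<^sup>2 \<le> 0"
        using 1 unfolding power2_norm_eq_inner by (simp add: algebra_simps inner_commute)
      then show False using x(3) by simp
    qed
    moreover have "dist z x \<le> 2 * e"
      using dist_triangle[of z x p] p(1) calculation Re by (auto simp: R_def)
    ultimately have "f x \<noteq> 0" using y(2)[of x] by (auto simp: T_def)
    then show ?thesis using nonneg[of x] x(1) sub by force
  qed
  show ?thesis
    by (rule that[of R "R/2" q y]) (use R qy sub pos y(1) in \<open>auto simp: T_def\<close>)
qed

lemma bounded_norm_on_compact:
  fixes g :: "'a::metric_space \<Rightarrow> 'b::real_normed_vector"
  assumes "continuous_on S g" "compact K" "K \<subseteq> S"
  obtains B where "B \<ge> 0" "\<And>x. x \<in> K \<Longrightarrow> norm (g x) \<le> B"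
proof -
  have "bounded (g ` K)"
    using assms by (intro compact_imp_bounded compact_continuous_image) (auto intro: continuous_on_subset)
  then show ?thesis using that unfolding bounded_pos by (metis imageI less_imp_le)
qed

text \<open>
  The differential inequality \<open>\<Delta>f - (b, \<nabla>f) \<le> c f\<close> is only required, at each point, of some function touching
  \<open>f\<close> from above; such functions are known explicitly for infima over a parameter.
\<close>

lemma strong_minimum:
  fixes f :: "real^'n::finite \<Rightarrow> real" and b :: "real^'n \<Rightarrow> real^'n" and c :: "real^'n \<Rightarrow> real"
  assumes S: "open S" "connected S" and contf: "continuous_on S f"
    and nonneg: "\<And>x. x \<in> S \<Longrightarrow> f x \<ge> 0"
    and contb: "continuous_on S b" and contc: "continuous_on S c"
    and touch: "\<And>x. x \<in> S \<Longrightarrow> \<exists>F a d. F x = f x \<and> (\<forall>\<^sub>F y in nhds x. f y \<le> F y) \<and>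
      (\<forall>i. jet2 (\<lambda>t. F (x + t *\<^sub>R axis i 1)) (a $ i) (d i)) \<and>
      (\<Sum>i\<in>UNIV. d i) - b x \<bullet> a \<le> c x * f x"
    and x0: "x0 \<in> S" "f x0 = 0" and "x1 \<in> S"
  shows "f x1 = 0"
proof (rule ccontr)
  assume "f x1 \<noteq> 0"
  then obtain y q R r where R: "R > 0" "r > 0" "r \<le> R / 2" "dist q y = R" "cball y r \<subseteq> S" "f y = 0"
    and pos: "\<And>x. \<lbrakk>x \<in> cball y r; x \<in> cball q R; x \<noteq> y\<rbrakk> \<Longrightarrow> f x > 0"
    using zero_set_touching_ball[OF S contf nonneg x0 \<open>x1 \<in> S\<close>] by metis
  obtain B where B: "B \<ge> 0" "\<And>x. x \<in> cball y r \<Longrightarrow> norm (b x) \<le> B"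
    using bounded_norm_on_compact[OF contb _ R(5)] by auto
  obtain C where C: "C \<ge> 0" "\<And>x. x \<in> cball y r \<Longrightarrow> norm (c x) \<le> C"
    using bounded_norm_on_compact[OF contc _ R(5)] by auto
  define N where "N = real CARD('n)"
  \<comment> \<open>On \<open>cball y r\<close> the distance to \<open>q\<close> is between
    \<open>R / 2\<close> and \<open>3 * R / 2\<close>, as \<open>r \<le> R / 2\<close>. These two
    bounds turn the second-order term into \<open>\<alpha>\<^sup>2 * R\<^sup>2\<close> and the drift
    into at most \<open>3 * \<alpha> * B * R\<close>. The final summand 1 gives
    \<open>\<alpha> \<ge> 1\<close>.\<close>
  define \<alpha> where "\<alpha> = (2 * N + 3 * B * R + C + 1) / R\<^sup>2 + 1"
  have \<alpha>1: "\<alpha> \<ge> 1" using R B C by (simp add: \<alpha>_def N_def)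
  have "\<alpha> * R\<^sup>2 = (2 * N + 3 * B * R + C + 1) + R\<^sup>2"
    using R by (simp add: \<alpha>_def field_simps)
  then have "\<alpha> * R\<^sup>2 - 2 * N - 3 * B * R \<ge> C + 1" by simp
  then have "1 * (C + 1) \<le> \<alpha> * (\<alpha> * R\<^sup>2 - 2 * N - 3 * B * R)"
    using \<alpha>1 C by (intro mult_mono) auto
  then have \<alpha>: "\<alpha>\<^sup>2 * R\<^sup>2 - 2 * \<alpha> * N - 3 * \<alpha> * B * R > C"
    by (simp add: algebra_simps power2_eq_square)
  \<comment> \<open>Hopf's barrier \<open>h\<close>: \<open>\<alpha>\<close> is so large that \<open>\<Delta>h - (b, \<nabla>h) > C E \<ge> C h\<close> on \<open>cball y r\<close>.\<close>
  define E where "E = (\<lambda>x. exp (- \<alpha> * (norm (x - q))\<^sup>2))"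
  define h where "h = (\<lambda>x. E x - exp (- \<alpha> * R\<^sup>2))"
  have h_le: "h x \<le> E x" "E x \<le> 1" "E x > 0" for x
    using \<alpha>1 by (auto simp: h_def E_def)
  have h_out: "h x < 0" if "x \<notin> cball q R" for x
  proof -
    have "R < norm (x - q)" using that by (simp add: dist_norm norm_minus_commute)
    then have "R\<^sup>2 < (norm (x - q))\<^sup>2" using R by (intro power_strict_mono) auto
    then show ?thesis using \<alpha>1 by (simp add: h_def E_def)
  qed
  have hy: "h y = 0" using R by (simp add: h_def E_def dist_norm norm_minus_commute)
  have contfr: "continuous_on (cball y r) f" using contf R(5) continuous_on_subset by blast
  have conth: "continuous_on X h" for X
    unfolding h_def E_def by (intro continuous_intros)
  \<comment> \<open>With this \<open>\<epsilon>\<close>, \<open>f - \<epsilon> * h\<close> is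
    positive on the whole sphere: inside \<open>cball q R\<close> because \<open>h \<le> 1\<close>,
    outside because \<open>h < 0 \<le> f\<close>. At the centre \<open>y\<close> it is 0, so its
    minimum over the closed ball is attained in the interior.\<close>
  obtain \<epsilon> where \<epsilon>: "\<epsilon> > 0" "\<And>x. \<lbrakk>x \<in> sphere y r; x \<in> cball q R\<rbrakk> \<Longrightarrow> \<epsilon> < f x"
  proof (cases "sphere y r \<inter> cball q R = {}")
    case True
    then show ?thesis by (intro that[of 1]) (auto simp: disjoint_iff)
  next
    case False
    have "compact (sphere y r \<inter> cball q R)" by (intro compact_Int_closed) auto
    then obtain z where z: "z \<in> sphere y r \<inter> cball q R" "\<And>x. x \<in> sphere y r \<inter> cball q R \<Longrightarrow> f z \<le> f x"
      using continuous_attains_inf[of "sphere y r \<inter> cball q R" f] False contfr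
      by (meson continuous_on_subset inf.coboundedI1 sphere_cball)
    have "f z > 0" using pos[of z] z(1) R by auto
    then show ?thesis using that[of "f z / 2"] z(2) by fastforce
  qed
  have "continuous_on (cball y r) (\<lambda>x. f x - \<epsilon> * h x)"
    by (intro continuous_intros contfr conth)
  then obtain x where x: "x \<in> cball y r" "\<And>z. z \<in> cball y r \<Longrightarrow> f x - \<epsilon> * h x \<le> f z - \<epsilon> * h z"
    using continuous_attains_inf[of "cball y r" "\<lambda>x. f x - \<epsilon> * h x"] R(2) by auto
  have fx: "f x \<le> \<epsilon> * h x" using x(2)[of y] R(2,6) hy by simp
  have xS: "x \<in> S" using x(1) R(5) by auto
  have "x \<notin> sphere y r"
  proof
    assume s: "x \<in> sphere y r"
    show False
    proof (cases "x \<in> cball q R")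
      case True
      have "\<epsilon> * h x \<le> \<epsilon> * 1" using h_le[of x] \<epsilon>(1) by (intro mult_left_mono) auto
      then show False using \<epsilon>(2)[OF s True] fx by simp
    next
      case False
      have "\<epsilon> * h x < 0" using h_out[OF False] \<epsilon>(1) by (simp add: mult_pos_neg)
      then show False using fx nonneg[OF xS] by simp
    qed
  qed
  then have xb: "x \<in> ball y r" using x(1) by auto
  obtain F a d where F: "F x = f x" "\<forall>\<^sub>F z in nhds x. f z \<le> F z"
      and jet: "\<And>i. jet2 (\<lambda>t. F (x + t *\<^sub>R axis i 1)) (a $ i) (d i)"
      and le: "(\<Sum>i\<in>UNIV. d i) - b x \<bullet> a \<le> c x * f x"
    using touch[OF xS] by blast
  \<comment> \<open>\<open>F\<close> lies above \<open>f\<close> with equality at \<open>x\<close>,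
    so the minimum passes to \<open>F - \<epsilon> * h\<close>, which has jets along the axes
    although \<open>f\<close> may have none.\<close>
  have ev: "\<forall>\<^sub>F z in nhds x. F x - \<epsilon> * h x \<le> F z - \<epsilon> * h z"
    using F(2) eventually_nhds_in_open[OF open_ball xb]
  proof eventually_elim
    case (elim z)
    then show ?case using x(2)[of z] F(1) by auto
  qed
  have jh: "jet2 (\<lambda>t. h (x + t *\<^sub>R axis i 1)) (E x * (- 2 * \<alpha> * (x - q) $ i))
      (E x * (4 * \<alpha>\<^sup>2 * ((x - q) $ i)\<^sup>2 - 2 * \<alpha>))" for i
  proof -
    have "jet2 (\<lambda>t. - \<alpha> * (norm (x + t *\<^sub>R axis i 1 - q))\<^sup>2) (- \<alpha> * (2 * (x - q) $ i)) (- \<alpha> * (2 * 1))"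
      unfolding norm_line_sq by (intro jet2_cmult jet2_quadratic)
    from jet2_diff[OF jet2_exp[OF this] jet2_const[of "exp (- \<alpha> * R\<^sup>2)"]]
    have "jet2 (\<lambda>t. h (x + t *\<^sub>R axis i 1)) (E x * (- \<alpha> * (2 * (x - q) $ i)) - 0)
      (E x * ((- \<alpha> * (2 * (x - q) $ i))\<^sup>2 + - \<alpha> * (2 * 1)) - 0)"
      by (simp add: h_def E_def)
    moreover have "E x * (- \<alpha> * (2 * (x - q) $ i)) - 0 = E x * (- 2 * \<alpha> * (x - q) $ i)"
      by (simp add: algebra_simps)
    moreover have "E x * ((- \<alpha> * (2 * (x - q) $ i))\<^sup>2 + - \<alpha> * (2 * 1)) - 0
        = E x * (4 * \<alpha>\<^sup>2 * ((x - q) $ i)\<^sup>2 - 2 * \<alpha>)"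
      by (simp add: power2_eq_square algebra_simps)
    ultimately show ?thesis by (simp only:)
  qed
  have min: "a $ i - \<epsilon> * (E x * (- 2 * \<alpha> * (x - q) $ i)) = 0 \<and>
      d i - \<epsilon> * (E x * (4 * \<alpha>\<^sup>2 * ((x - q) $ i)\<^sup>2 - 2 * \<alpha>)) \<ge> 0" for i
    by (rule jet2_local_min[OF jet2_diff[OF jet jet2_cmult[OF jh]]])
       (use eventually_nhds_line[OF ev, of "axis i 1"] in simp)
  define \<rho> where "\<rho> = norm (x - q)"
  have \<rho>: "R / 2 \<le> \<rho>" "\<rho> \<le> 3 * R / 2"
    using dist_triangle[of q y x] dist_triangle[of q x y] R(3,4) xb
    by (auto simp: \<rho>_def dist_norm norm_minus_commute)
  have "a = (- 2 * \<alpha> * \<epsilon> * E x) *\<^sub>R (x - q)"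
    using min by (simp add: vec_eq_iff algebra_simps)
  then have ba: "b x \<bullet> a = - 2 * \<alpha> * \<epsilon> * E x * (b x \<bullet> (x - q))" by simp
  have "(\<Sum>i\<in>UNIV. d i) \<ge> (\<Sum>i\<in>UNIV. \<epsilon> * (E x * (4 * \<alpha>\<^sup>2 * ((x - q) $ i)\<^sup>2 - 2 * \<alpha>)))"
    using min by (intro sum_mono) (simp add: algebra_simps)
  also have "(\<Sum>i\<in>UNIV. \<epsilon> * (E x * (4 * \<alpha>\<^sup>2 * ((x - q) $ i)\<^sup>2 - 2 * \<alpha>)))
      = \<epsilon> * E x * (4 * \<alpha>\<^sup>2 * (\<Sum>i\<in>UNIV. ((x - q) $ i)\<^sup>2) - 2 * \<alpha> * N)"
    by (simp add: sum_distrib_left sum_subtractf N_def algebra_simps)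
  also have "(\<Sum>i\<in>UNIV. ((x - q) $ i)\<^sup>2) = \<rho>\<^sup>2"
    unfolding \<rho>_def power2_norm_eq_inner inner_vec_def by (simp add: power2_eq_square)
  finally have "\<epsilon> * E x * (4 * \<alpha>\<^sup>2 * \<rho>\<^sup>2 - 2 * \<alpha> * N + 2 * \<alpha> * (b x \<bullet> (x - q))) \<le> c x * f x"
    using le ba by (simp add: algebra_simps)
  \<comment> \<open>\<open>h\<close> is replaced by the larger \<open>E\<close>, so that the
    positive factor \<open>\<epsilon> * E x\<close> can be cancelled from both sides.\<close>
  also have "c x * f x \<le> C * (\<epsilon> * E x)"
  proof (intro mult_mono)
    show "c x \<le> C" using C(2)[OF x(1)] by simp
    show "f x \<le> \<epsilon> * E x" using fx h_le(1)[of x] \<epsilon>(1) by (meson less_imp_le mult_left_mono order_trans)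
  qed (use C nonneg[OF xS] in auto)
  finally have "\<epsilon> * E x * (4 * \<alpha>\<^sup>2 * \<rho>\<^sup>2 - 2 * \<alpha> * N + 2 * \<alpha> * (b x \<bullet> (x - q))) \<le> \<epsilon> * E x * C"
    by (simp add: algebra_simps)
  then have 1: "4 * \<alpha>\<^sup>2 * \<rho>\<^sup>2 - 2 * \<alpha> * N + 2 * \<alpha> * (b x \<bullet> (x - q)) \<le> C"
    using \<epsilon>(1) h_le(3)[of x] by (simp add: mult_le_cancel_left_pos)
  have "(R / 2)\<^sup>2 \<le> \<rho>\<^sup>2" using \<rho> R by (intro power_mono) auto
  then have "\<alpha>\<^sup>2 * R\<^sup>2 \<le> 4 * \<alpha>\<^sup>2 * \<rho>\<^sup>2" using mult_left_mono[of "(R/2)\<^sup>2" "\<rho>\<^sup>2" "4 * \<alpha>\<^sup>2"]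
    by (simp add: power_divide)
  moreover have "\<bar>b x \<bullet> (x - q)\<bar> \<le> B * (3 * R / 2)"
    using Cauchy_Schwarz_ineq2[of "b x" "x - q"] mult_mono[of "norm (b x)" B "norm (x - q)" "3 * R / 2"]
      B(2)[OF x(1)] \<rho> B(1) by (simp add: \<rho>_def)
  then have "\<alpha> * (b x \<bullet> (x - q)) \<ge> \<alpha> * (- (B * (3 * R / 2)))"
    using \<alpha>1 by (intro mult_left_mono) auto
  ultimately show False using 1 \<alpha> by (simp add: algebra_simps)
qed

section \<open>Calculus of smooth functions\<close>

lemma partial_deriv_eq:
  "(f has_derivative D) (at x) \<Longrightarrow> partial_deriv i f x = D (axis i 1)"
  unfolding partial_deriv_def by (metis frechet_derivative_at)

text \<open>\<open>frechet_derivative\<close> chooses from the set of derivatives at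
  \<open>x\<close>, and this set is the same for \<open>f\<close> and \<open>g\<close>; hence
  equality even where it is empty.\<close>

lemma partial_deriv_cong:
  assumes "open S" "x \<in> S" "\<And>y. y \<in> S \<Longrightarrow> f y = g y"
  shows "partial_deriv i f x = partial_deriv i g x"
proof -
  have "(f has_derivative D) (at x) \<longleftrightarrow> (g has_derivative D) (at x)" for D
    using assms has_derivative_transform_within_open[OF _ assms(1,2)] by metis
  then show ?thesis unfolding partial_deriv_def frechet_derivative_def by simp
qed

lemma partial_deriv_add:
  assumes "f differentiable (at x)" "g differentiable (at x)"
  shows "partial_deriv i (\<lambda>y. f y + g y) x = partial_deriv i f x + partial_deriv i g x"
  using partial_deriv_eq[OF has_derivative_add[OF assms[unfolded frechet_derivative_works]]]
  by (simp add: partial_deriv_def)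

lemma partial_deriv_mult:
  fixes f g :: "real^'n::finite \<Rightarrow> real"
  assumes "f differentiable (at x)" "g differentiable (at x)"
  shows "partial_deriv i (\<lambda>y. f y * g y) x = f x * partial_deriv i g x + partial_deriv i f x * g x"
  using partial_deriv_eq[OF has_derivative_mult[OF assms[unfolded frechet_derivative_works]]]
  by (simp add: partial_deriv_def)

lemma partial_deriv_const: "partial_deriv i (\<lambda>y. c) x = 0"
  using partial_deriv_eq[OF has_derivative_const] .

lemma partial_deriv_sum:
  assumes "\<And>k. k \<in> A \<Longrightarrow> f k differentiable (at x)"
  shows "partial_deriv i (\<lambda>y. \<Sum>k\<in>A. f k y) x = (\<Sum>k\<in>A. partial_deriv i (f k) x)"
  using partial_deriv_eq[OF has_derivative_sum, of A f "\<lambda>k. frechet_derivative (f k) (at x)" x i]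
    assms[unfolded frechet_derivative_works] by (simp add: partial_deriv_def)

lemma differentiable_nth: "(\<lambda>y::real^'n::finite. y $ k) differentiable (at x)"
  using bounded_linear_imp_differentiable[OF bounded_linear_vec_nth] .

lemma partial_deriv_nth:
  "partial_deriv i (\<lambda>y::real^'n::finite. y $ k) x = (if k = i then 1 else 0)"
proof -
  have "((\<lambda>y::real^'n. y $ k) has_derivative (\<lambda>y. y $ k)) (at x)"
    by (rule bounded_linear_imp_has_derivative[OF bounded_linear_vec_nth])
  from partial_deriv_eq[OF this, of i] show ?thesis by (simp add: axis_def)
qed

lemma differentiable_line:
  fixes f :: "real^'n::finite \<Rightarrow> real"
  assumes "f differentiable (at (x + t *\<^sub>R v))"
  shows "((\<lambda>t. f (x + t *\<^sub>R v)) has_real_derivative (\<Sum>i\<in>UNIV. v $ i * partial_deriv i f (x + t *\<^sub>R v))) (at t)"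
proof -
  let ?D = "frechet_derivative f (at (x + t *\<^sub>R v))"
  have D: "(f has_derivative ?D) (at (x + t *\<^sub>R v))"
    using assms unfolding frechet_derivative_works .
  interpret D: bounded_linear ?D using D by (rule has_derivative_bounded_linear)
  have "((\<lambda>t. f (x + t *\<^sub>R v)) has_derivative (\<lambda>s. ?D (s *\<^sub>R v))) (at t)"
    by (rule has_derivative_compose[of "\<lambda>t. x + t *\<^sub>R v" _ t UNIV f ?D, OF _ D])
      (auto intro!: derivative_eq_intros)
  moreover have "?D v = (\<Sum>i\<in>UNIV. v $ i * partial_deriv i f (x + t *\<^sub>R v))"
  proof -
    have "?D v = ?D (\<Sum>i\<in>UNIV. v $ i *\<^sub>R axis i 1)"
      using basis_expansion[of v] by (simp add: scalar_mult_eq_scaleR)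
    then show ?thesis by (simp add: D.sum D.scaleR partial_deriv_def)
  qed
  ultimately show ?thesis by (simp add: has_field_derivative_def D.scaleR mult.commute[of _ "sum _ _"] mult_commute_abs)
qed

lemma differentiable_line_axis:
  fixes f :: "real^'n::finite \<Rightarrow> real"
  assumes "f differentiable (at (x + t *\<^sub>R axis i 1))"
  shows "((\<lambda>t. f (x + t *\<^sub>R axis i 1)) has_real_derivative partial_deriv i f (x + t *\<^sub>R axis i 1)) (at t)"
  using differentiable_line[OF assms] by (simp add: axis_def if_distrib if_distribR cong: if_cong)

lemma Ck_on_Suc_imp: "Ck_on (Suc k) S f \<Longrightarrow> Ck_on k S f"
proof (induction k arbitrary: f)
  case 0
  then show ?case
    by (auto intro!: continuous_at_imp_continuous_on differentiable_imp_continuous_within)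
qed auto

text \<open>\<open>partial_deriv i f\<close> is a function on the whole space, but the rules of
  differentiation identify it with a formula on \<open>S\<close> only. This carries regularity over
  from the formula.\<close>

lemma Ck_on_cong:
  assumes "open S"
  shows "Ck_on k S f \<Longrightarrow> (\<And>x. x \<in> S \<Longrightarrow> f x = g x) \<Longrightarrow> Ck_on k S g"
proof (induction k arbitrary: f g)
  case 0
  then show ?case using continuous_on_cong by force
next
  case (Suc k)
  have "g differentiable (at x)" if "x \<in> S" for x
    using Suc.prems that has_derivative_transform_within_open[OF _ assms that]
    unfolding Ck_on.simps differentiable_def by metis
  moreover have "Ck_on k S (partial_deriv i g)" for i
    using Suc.IH[of "partial_deriv i f" "partial_deriv i g"] Suc.prems
      partial_deriv_cong[OF assms _ Suc.prems(2)] by auto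
  ultimately show ?case by simp
qed

lemma Ck_on_add:
  assumes "open S"
  shows "Ck_on k S f \<Longrightarrow> Ck_on k S g \<Longrightarrow> Ck_on k S (\<lambda>x. f x + g x)"
proof (induction k arbitrary: f g)
  case 0
  then show ?case by (auto intro: continuous_on_add)
next
  case (Suc k)
  have "Ck_on k S (partial_deriv i (\<lambda>x. f x + g x))" for i
    by (rule Ck_on_cong[OF assms Suc.IH[of "partial_deriv i f" "partial_deriv i g"]])
       (use Suc.prems in \<open>auto simp: partial_deriv_add\<close>)
  then show ?case using Suc.prems by auto
qed

lemma Ck_on_mult:
  assumes "open S"
  shows "Ck_on k S f \<Longrightarrow> Ck_on k S g \<Longrightarrow> Ck_on k S (\<lambda>x. f x * g x)"
proof (induction k arbitrary: f g)
  case 0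
  then show ?case by (auto intro: continuous_on_mult)
next
  case (Suc k)
  have "Ck_on k S f" "Ck_on k S g" using Suc.prems by (blast intro: Ck_on_Suc_imp)+
  then have "Ck_on k S (\<lambda>x. f x * partial_deriv i g x + partial_deriv i f x * g x)" for i
    using Suc by (intro Ck_on_add[OF assms] Suc.IH) auto
  then have "Ck_on k S (partial_deriv i (\<lambda>x. f x * g x))" for i
    by (rule Ck_on_cong[OF assms]) (use Suc.prems in \<open>auto simp: partial_deriv_mult\<close>)
  then show ?case using Suc.prems by auto
qed

lemma Ck_on_const: "Ck_on k (S :: (real^'n::finite) set) (\<lambda>x. c)"
proof (induction k arbitrary: c)
  case (Suc k)
  have "partial_deriv i (\<lambda>x::real^'n. c) = (\<lambda>x. 0)" for i by (rule ext) (rule partial_deriv_const)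
  then show ?case using Suc by simp
qed auto

text \<open>The right-hand side is built from products and \<open>inverse\<close> alone, so that the
  closure rules for \<open>Ck_on\<close> apply to it as it stands.\<close>

lemma partial_deriv_inverse:
  fixes f :: "real^'n::finite \<Rightarrow> real"
  assumes "f differentiable (at x)" "f x \<noteq> 0"
  shows "partial_deriv i (\<lambda>y. inverse (f y)) x = (-1 * partial_deriv i f x) * (inverse (f x) * inverse (f x))"
proof -
  have *: "((\<lambda>y. inverse (f y)) has_derivative
      (\<lambda>h. - (frechet_derivative f (at x) h * (inverse (f x) * inverse (f x))))) (at x)"
    using assms(1)[unfolded frechet_derivative_works] assms(2)
    by (auto intro!: derivative_eq_intros simp: algebra_simps)
  show ?thesis using partial_deriv_eq[OF *] by (simp add: partial_deriv_def)
qed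

lemma Ck_on_inverse:
  assumes "open S" "\<And>x. x \<in> S \<Longrightarrow> f x \<noteq> 0"
  shows "Ck_on k S f \<Longrightarrow> Ck_on k S (\<lambda>x. inverse (f x))"
proof (induction k)
  case 0
  then show ?case using assms by (auto intro: continuous_on_inverse)
next
  case (Suc k)
  have "Ck_on k S (\<lambda>x. inverse (f x))" by (rule Suc.IH[OF Ck_on_Suc_imp[OF Suc.prems]])
  then have "Ck_on k S (\<lambda>x. (-1 * partial_deriv i f x) * (inverse (f x) * inverse (f x)))" for i
    using Suc.prems by (intro Ck_on_mult[OF assms(1)] Ck_on_const) auto
  then have "Ck_on k S (partial_deriv i (\<lambda>x. inverse (f x)))" for i
    by (rule Ck_on_cong[OF assms(1)]) (use Suc.prems assms in \<open>auto simp: partial_deriv_inverse\<close>)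
  then show ?case using Suc.prems assms by (auto intro: differentiable_inverse)
qed

lemma smooth_on_partial: "smooth_on S f \<Longrightarrow> smooth_on S (partial_deriv i f)"
  unfolding smooth_on_def by (metis Ck_on.simps(2))

lemma smooth_on_differentiable: "smooth_on S f \<Longrightarrow> x \<in> S \<Longrightarrow> f differentiable (at x)"
  unfolding smooth_on_def by (metis Ck_on.simps(2))

lemma smooth_on_continuous: "smooth_on S f \<Longrightarrow> continuous_on S f"
  unfolding smooth_on_def by (metis Ck_on.simps(1))

lemma partial_deriv_minus_ln:
  fixes f :: "real^'n::finite \<Rightarrow> real"
  assumes "f differentiable (at x)" "f x > 0"
  shows "(\<lambda>y. - ln (f y)) differentiable (at x)"
    and "partial_deriv i (\<lambda>y. - ln (f y)) x = (-1 * partial_deriv i f x) * inverse (f x)"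
proof -
  have *: "((\<lambda>y. - ln (f y)) has_derivative
      (\<lambda>h. - (frechet_derivative f (at x) h * inverse (f x)))) (at x)"
    using assms(1)[unfolded frechet_derivative_works] assms(2)
    by (auto intro!: derivative_eq_intros)
  show "(\<lambda>y. - ln (f y)) differentiable (at x)" using * differentiable_def by blast
  show "partial_deriv i (\<lambda>y. - ln (f y)) x = (-1 * partial_deriv i f x) * inverse (f x)"
    using partial_deriv_eq[OF *] by (simp add: partial_deriv_def)
qed

text \<open>The logarithm disappears after one differentiation: the first partial derivatives are
  quotients of smooth functions, hence of class \<open>Ck_on k\<close> for every
  \<open>k\<close>.\<close>

lemma smooth_on_minus_ln:
  fixes f :: "real^'n::finite \<Rightarrow> real"
  assumes "open S" "smooth_on S f" "\<And>x. x \<in> S \<Longrightarrow> f x > 0"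
  shows "smooth_on S (\<lambda>x. - ln (f x))"
  unfolding smooth_on_def
proof
  fix k
  have d: "f differentiable (at x)" if "x \<in> S" for x
    using that assms(2) by (rule smooth_on_differentiable[rotated])
  have "Ck_on k S (\<lambda>x. (-1 * partial_deriv i f x) * inverse (f x))" for k i
    using smooth_on_partial[OF assms(2), of i] assms(2,3)
    by (intro Ck_on_mult[OF assms(1)] Ck_on_const Ck_on_inverse[OF assms(1)])
       (auto simp: smooth_on_def less_le)
  then have "Ck_on k S (partial_deriv i (\<lambda>x. - ln (f x)))" for k i
    by (rule Ck_on_cong[OF assms(1)]) (use d assms in \<open>auto simp: partial_deriv_minus_ln\<close>)
  then have "Ck_on (Suc k) S (\<lambda>x. - ln (f x))"
    using d assms by (auto intro: partial_deriv_minus_ln(1))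
  then show "Ck_on k S (\<lambda>x. - ln (f x))" by (rule Ck_on_Suc_imp)
qed

section \<open>Jets of smooth functions along lines\<close>

lemma smooth_on_jet2:
  fixes f :: "real^'n::finite \<Rightarrow> real"
  assumes "open S" "smooth_on S f" "x \<in> S"
  shows "jet2 (\<lambda>t. f (x + t *\<^sub>R v)) (\<Sum>i\<in>UNIV. v $ i * partial_deriv i f x)
    (\<Sum>i\<in>UNIV. v $ i * (\<Sum>j\<in>UNIV. v $ j * partial_deriv j (partial_deriv i f) x))"
proof -
  let ?g = "\<lambda>t. \<Sum>i\<in>UNIV. v $ i * partial_deriv i f (x + t *\<^sub>R v)"
  have "\<forall>\<^sub>F t in nhds 0. x + t *\<^sub>R v \<in> S"
    using eventually_nhds_line eventually_nhds_in_open[OF assms(1,3)] by blast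
  then have "\<forall>\<^sub>F t in nhds 0. ((\<lambda>t. f (x + t *\<^sub>R v)) has_real_derivative ?g t) (at t)"
    by eventually_elim (intro differentiable_line smooth_on_differentiable[OF assms(2)])
  moreover have "((\<lambda>t. partial_deriv i f (x + t *\<^sub>R v)) has_real_derivative
      (\<Sum>j\<in>UNIV. v $ j * partial_deriv j (partial_deriv i f) x)) (at 0)" for i
    using differentiable_line[of "partial_deriv i f" x 0 v]
      smooth_on_differentiable[OF smooth_on_partial[OF assms(2)] assms(3)] by simp
  then have "(?g has_real_derivative
      (\<Sum>i\<in>UNIV. v $ i * (\<Sum>j\<in>UNIV. v $ j * partial_deriv j (partial_deriv i f) x))) (at 0)"
    by (intro DERIV_sum DERIV_cmult)
  ultimately show ?thesis unfolding jet2_def by (intro exI[of _ ?g]) simp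
qed

lemma smooth_on_jet2_axis:
  fixes f :: "real^'n::finite \<Rightarrow> real"
  assumes "open S" "smooth_on S f" "x \<in> S"
  shows "jet2 (\<lambda>t. f (x + t *\<^sub>R axis i 1)) (partial_deriv i f x) (partial_deriv i (partial_deriv i f) x)"
  using smooth_on_jet2[OF assms, of "axis i 1"]
  by (simp add: axis_def if_distrib if_distribR cong: if_cong)

section \<open>Equality of mixed partial derivatives\<close>

lemma second_difference_mvt:
  fixes f :: "real^'n::finite \<Rightarrow> real"
  assumes "h > 0" "cball x (2 * h) \<subseteq> S" "Ck_on 2 S f"
  obtains p where "dist x p \<le> 2 * h"
    "f (x + h *\<^sub>R axis i 1 + h *\<^sub>R axis j 1) - f (x + h *\<^sub>R axis i 1) - f (x + h *\<^sub>R axis j 1) + f x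
      = h\<^sup>2 * partial_deriv j (partial_deriv i f) p"
proof -
  have near: "dist x (x + s *\<^sub>R axis i 1 + t *\<^sub>R axis j 1) \<le> 2 * h"
    if "0 \<le> s" "s \<le> h" "0 \<le> t" "t \<le> h" for s t
  proof -
    have "dist x (x + s *\<^sub>R axis i 1 + t *\<^sub>R axis j 1) = norm (s *\<^sub>R axis i 1 + t *\<^sub>R axis j (1::real))"
      by (subst dist_commute) (simp add: dist_norm add.assoc)
    also have "\<dots> \<le> \<bar>s\<bar> + \<bar>t\<bar>"
      by (rule order_trans[OF norm_triangle_ineq]) simp
    finally show ?thesis using that by simp
  qed
  have inS: "x + s *\<^sub>R axis i 1 + t *\<^sub>R axis j 1 \<in> S" if "0 \<le> s" "s \<le> h" "0 \<le> t" "t \<le> h" for s t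
    using near[OF that] assms(2) by auto
  have d: "f differentiable (at y)" "partial_deriv i f differentiable (at y)" if "y \<in> S" for y
    using assms(3) that by (auto simp: numeral_2_eq_2)
  \<comment> \<open>The second difference is \<open>\<phi> h - \<phi> 0\<close>. The mean value
    theorem in direction \<open>i\<close> produces a difference of first derivatives, and a second
    application in direction \<open>j\<close> produces the mixed derivative.\<close>
  define \<phi> where "\<phi> = (\<lambda>s. f (x + h *\<^sub>R axis j 1 + s *\<^sub>R axis i 1) - f (x + s *\<^sub>R axis i 1))"
  have "(\<phi> has_real_derivative partial_deriv i f (x + h *\<^sub>R axis j 1 + s *\<^sub>R axis i 1)
      - partial_deriv i f (x + s *\<^sub>R axis i 1)) (at s)" if "0 \<le> s" "s \<le> h" for s
    unfolding \<phi>_def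
    using inS[of s 0] inS[of s h] assms(1) that
    by (intro DERIV_diff differentiable_line_axis d) (auto simp: algebra_simps)
  from MVT2[OF assms(1), of \<phi>, OF this] obtain s where s: "0 < s" "s < h"
    "\<phi> h - \<phi> 0 = (h - 0) * (partial_deriv i f (x + h *\<^sub>R axis j 1 + s *\<^sub>R axis i 1)
      - partial_deriv i f (x + s *\<^sub>R axis i 1))" by blast
  have "((\<lambda>t. partial_deriv i f (x + s *\<^sub>R axis i 1 + t *\<^sub>R axis j 1)) has_real_derivative
      partial_deriv j (partial_deriv i f) (x + s *\<^sub>R axis i 1 + t *\<^sub>R axis j 1)) (at t)"
    if "0 \<le> t" "t \<le> h" for t
    using inS[of s t] s that by (intro differentiable_line_axis d) auto
  from MVT2[OF assms(1), of "\<lambda>t. partial_deriv i f (x + s *\<^sub>R axis i 1 + t *\<^sub>R axis j 1)", OF this]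
  obtain t where t: "0 < t" "t < h" "partial_deriv i f (x + s *\<^sub>R axis i 1 + h *\<^sub>R axis j 1)
      - partial_deriv i f (x + s *\<^sub>R axis i 1 + 0 *\<^sub>R axis j 1)
      = (h - 0) * partial_deriv j (partial_deriv i f) (x + s *\<^sub>R axis i 1 + t *\<^sub>R axis j 1)" by blast
  show ?thesis
  proof (rule that)
    show "dist x (x + s *\<^sub>R axis i 1 + t *\<^sub>R axis j 1) \<le> 2 * h"
      using near s t by simp
    have "f (x + h *\<^sub>R axis i 1 + h *\<^sub>R axis j 1) - f (x + h *\<^sub>R axis i 1) - f (x + h *\<^sub>R axis j 1) + f x = \<phi> h - \<phi> 0"
      by (simp add: \<phi>_def add.assoc add.commute[of "h *\<^sub>R axis i 1"])
    also have "\<dots> = h * (partial_deriv i f (x + s *\<^sub>R axis i 1 + h *\<^sub>R axis j 1)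
      - partial_deriv i f (x + s *\<^sub>R axis i 1 + 0 *\<^sub>R axis j 1))"
      using s(3) by (simp add: add.assoc add.commute[of "h *\<^sub>R axis j 1"])
    finally show "f (x + h *\<^sub>R axis i 1 + h *\<^sub>R axis j 1) - f (x + h *\<^sub>R axis i 1) - f (x + h *\<^sub>R axis j 1) + f x
      = h\<^sup>2 * partial_deriv j (partial_deriv i f) (x + s *\<^sub>R axis i 1 + t *\<^sub>R axis j 1)"
      unfolding t(3) by (simp add: power2_eq_square)
  qed
qed

text \<open>The second difference is symmetric in \<open>i\<close> and \<open>j\<close>, so the two
  mixed derivatives agree at two points \<open>p\<close> and \<open>q\<close> within
  \<open>2 * h\<close> of \<open>x\<close>. Continuity then makes them agree at
  \<open>x\<close>.\<close>

lemma partial_deriv_commute: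
  fixes f :: "real^'n::finite \<Rightarrow> real"
  assumes "open S" "Ck_on 2 S f" "x \<in> S"
  shows "partial_deriv i (partial_deriv j f) x = partial_deriv j (partial_deriv i f) x"
proof (rule ccontr)
  let ?P = "\<lambda>k l. partial_deriv k (partial_deriv l f)"
  assume ne: "?P i j x \<noteq> ?P j i x"
  define e where "e = \<bar>?P i j x - ?P j i x\<bar> / 2"
  have e: "e > 0" using ne by (simp add: e_def)
  have "continuous (at x) (?P k l)" for k l
  proof -
    have "continuous_on S (?P k l)" using assms(2) by (simp add: numeral_2_eq_2)
    then show ?thesis using assms(1,3) by (simp add: continuous_on_eq_continuous_at)
  qed
  then have "\<exists>r>0. \<forall>p. dist p x < r \<longrightarrow> dist (?P k l p) (?P k l x) < e" for k l
    using e unfolding continuous_at_eps_delta by blast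
  then obtain r1 r2 where r: "r1 > 0" "\<And>p. dist p x < r1 \<Longrightarrow> dist (?P i j p) (?P i j x) < e"
      "r2 > 0" "\<And>p. dist p x < r2 \<Longrightarrow> dist (?P j i p) (?P j i x) < e"
    by metis
  obtain r3 where r3: "r3 > 0" "cball x r3 \<subseteq> S" using assms(1,3) open_contains_cball by blast
  define h where "h = min r3 (min r1 r2) / 3"
  have h: "h > 0" "2 * h < r1" "2 * h < r2" "2 * h \<le> r3" using r(1,3) r3(1) by (auto simp: h_def)
  have sub: "cball x (2 * h) \<subseteq> S" using h(4) r3(2) by auto
  obtain p where p: "dist x p \<le> 2 * h"
    "f (x + h *\<^sub>R axis i 1 + h *\<^sub>R axis j 1) - f (x + h *\<^sub>R axis i 1) - f (x + h *\<^sub>R axis j 1) + f x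
      = h\<^sup>2 * ?P j i p"
    using second_difference_mvt[OF h(1) sub assms(2)] by metis
  obtain q where q: "dist x q \<le> 2 * h"
    "f (x + h *\<^sub>R axis j 1 + h *\<^sub>R axis i 1) - f (x + h *\<^sub>R axis j 1) - f (x + h *\<^sub>R axis i 1) + f x
      = h\<^sup>2 * ?P i j q"
    using second_difference_mvt[OF h(1) sub assms(2)] by metis
  have "h\<^sup>2 * ?P j i p = h\<^sup>2 * ?P i j q"
    using p(2) q(2) by (simp add: algebra_simps)
  then have "?P j i p = ?P i j q" using h(1) by simp
  moreover have "dist (?P i j q) (?P i j x) < e" "dist (?P j i p) (?P j i x) < e"
    using r(2)[of q] r(4)[of p] p(1) q(1) h by (auto simp: dist_commute)
  ultimately have "dist (?P i j x) (?P j i x) < 2 * e"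
    using dist_triangle3[of "?P i j x" "?P j i x" "?P i j q"] by simp
  then show False by (simp add: e_def dist_real_def)
qed

section \<open>From nonnegative to positive Hessian\<close>

text \<open>Exchanging the two sums brings the quadratic form into the shape of the second
  coefficient in \<open>smooth_on_jet2\<close>.\<close>

lemma inner_hessian_mult:
  fixes f :: "real^'n::finite \<Rightarrow> real"
  shows "v \<bullet> (hessian f x *v v) = (\<Sum>i\<in>UNIV. v $ i * (\<Sum>j\<in>UNIV. v $ j * partial_deriv j (partial_deriv i f) x))"
proof -
  have "v \<bullet> (hessian f x *v v) =
      (\<Sum>j\<in>UNIV. \<Sum>i\<in>UNIV. v $ j * (partial_deriv j (partial_deriv i f) x * v $ i))"
    by (simp add: inner_vec_def matrix_vector_mult_def hessian_def sum_distrib_left)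
  also have "\<dots> = (\<Sum>i\<in>UNIV. \<Sum>j\<in>UNIV. v $ j * (partial_deriv j (partial_deriv i f) x * v $ i))"
    by (rule sum.swap)
  finally show ?thesis by (simp add: sum_distrib_left mult_ac)
qed

lemma smooth_on_jet2_hessian:
  fixes f :: "real^'n::finite \<Rightarrow> real"
  assumes "open S" "smooth_on S f" "x \<in> S"
  shows "jet2 (\<lambda>t. f (x + t *\<^sub>R v)) (gradient f x \<bullet> v) (v \<bullet> (hessian f x *v v))"
  using smooth_on_jet2[OF assms, of v] unfolding inner_hessian_mult
  by (simp add: gradient_def inner_vec_def mult.commute)

lemma transpose_hessian:
  fixes f :: "real^'n::finite \<Rightarrow> real"
  assumes "open S" "smooth_on S f" "x \<in> S"
  shows "transpose (hessian f x) = hessian f x"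
  using partial_deriv_commute[OF assms(1) _ assms(3), of f] assms(2)
  by (simp add: smooth_on_def transpose_def hessian_def vec_eq_iff)

text \<open>Division of the equation by \<open>u\<close>: one has
  \<open>\<partial>_i w = - \<partial>_i u / u\<close>, and the second derivatives of
  \<open>w\<close> are those of \<open>- u\<close>, divided by \<open>u\<close>, plus the products
  of first derivatives of \<open>w\<close>.\<close>

lemma neg_log_equation:
  fixes u :: "real^'n::finite \<Rightarrow> real"
  assumes S: "open S" "smooth_on S u" "x \<in> S" and pos: "\<And>x. x \<in> S \<Longrightarrow> u x > 0"
    and eq: "- laplacian u x + x \<bullet> gradient u x = l * u x"
    and w: "w = (\<lambda>y. - ln (u y))"
  shows "(\<Sum>i\<in>UNIV. partial_deriv i (partial_deriv i w) x) =
    l + (\<Sum>i\<in>UNIV. x $ i * partial_deriv i w x) + (\<Sum>i\<in>UNIV. partial_deriv i w x * partial_deriv i w x)"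
proof -
  have d: "u differentiable (at y)" "partial_deriv i u differentiable (at y)" if "y \<in> S" for y i
    using smooth_on_differentiable S that smooth_on_partial by blast+
  have d1: "partial_deriv i w y = (-1 * partial_deriv i u y) * inverse (u y)" if "y \<in> S" for y i
    unfolding w using partial_deriv_minus_ln(2)[OF d(1)[OF that] pos[OF that]] .
  have di: "(\<lambda>y. inverse (u y)) differentiable (at x)"
    using d(1)[OF S(3)] pos[OF S(3)] by (auto intro: differentiable_inverse)
  have d2: "partial_deriv i (partial_deriv i w) x =
      - partial_deriv i (partial_deriv i u) x / u x + partial_deriv i w x * partial_deriv i w x" for i
  proof -
    have "partial_deriv i (partial_deriv i w) x = partial_deriv i (\<lambda>y. (-1 * partial_deriv i u y) * inverse (u y)) x"
      by (rule partial_deriv_cong[OF S(1,3) d1])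
    also have "\<dots> = (-1 * partial_deriv i u x) * partial_deriv i (\<lambda>y. inverse (u y)) x
        + partial_deriv i (\<lambda>y. -1 * partial_deriv i u y) x * inverse (u x)"
      by (rule partial_deriv_mult[OF differentiable_mult[OF differentiable_const d(2)[OF S(3)]] di])
    also have "partial_deriv i (\<lambda>y. inverse (u y)) x = (-1 * partial_deriv i u x) * (inverse (u x) * inverse (u x))"
      using pos[OF S(3)] by (intro partial_deriv_inverse d(1)[OF S(3)]) simp
    also have "partial_deriv i (\<lambda>y. -1 * partial_deriv i u y) x = - partial_deriv i (partial_deriv i u) x"
      using partial_deriv_mult[OF differentiable_const d(2)[OF S(3)], of i "-1" i]
      by (simp add: partial_deriv_const)
    finally show ?thesis using d1[OF S(3), of i] by (simp add: divide_inverse algebra_simps)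
  qed
  have "(\<Sum>i\<in>UNIV. x $ i * partial_deriv i w x) = - (x \<bullet> gradient u x) / u x"
    by (simp add: d1[OF S(3)] inner_vec_def gradient_def divide_inverse sum_distrib_right sum_negf mult.assoc)
  moreover have "(\<Sum>i\<in>UNIV. partial_deriv i (partial_deriv i w) x) =
      - laplacian u x / u x + (\<Sum>i\<in>UNIV. partial_deriv i w x * partial_deriv i w x)"
    unfolding d2 by (simp add: sum.distrib sum_subtractf laplacian_def sum_negf sum_divide_distrib)
  moreover have "- laplacian u x / u x = l - (x \<bullet> gradient u x) / u x"
    using eq pos[OF S(3)] by (simp add: field_simps)
  ultimately show ?thesis by simp
qed

text \<open>Brings the innermost derivative to the outside; two uses move both derivatives of a
  Laplacian past \<open>partial_deriv j (partial_deriv k w)\<close>.\<close>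

lemma partial_deriv_rotate:
  fixes f :: "real^'n::finite \<Rightarrow> real"
  assumes "open S" "smooth_on S f" "x \<in> S"
  shows "partial_deriv j (partial_deriv k (partial_deriv i f)) x = partial_deriv i (partial_deriv j (partial_deriv k f)) x"
proof -
  have "partial_deriv j (partial_deriv k (partial_deriv i f)) x = partial_deriv j (partial_deriv i (partial_deriv k f)) x"
    by (rule partial_deriv_cong[OF assms(1,3)] partial_deriv_commute[OF assms(1)])+
       (use assms(2) in \<open>auto simp: smooth_on_def\<close>)
  also have "\<dots> = partial_deriv i (partial_deriv j (partial_deriv k f)) x"
    by (rule partial_deriv_commute[OF assms(1) _ assms(3)])
       (use smooth_on_partial[OF assms(2)] in \<open>auto simp: smooth_on_def\<close>)
  finally show ?thesis .
qed

text \<open>The equation is differentiated in direction \<open>k\<close>, then in direction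
  \<open>j\<close>. Each time the factor \<open>x $ i\<close> contributes one derivative of
  \<open>w\<close>, whence the first factor 2; the squared gradient gives the doubled drift and the
  product of Hessians.\<close>

lemma second_derivative_equation:
  fixes w :: "real^'n::finite \<Rightarrow> real"
  assumes S: "open S" "smooth_on S w"
    and eq: "\<And>x. x \<in> S \<Longrightarrow> (\<Sum>i\<in>UNIV. partial_deriv i (partial_deriv i w) x) =
      l + (\<Sum>i\<in>UNIV. x $ i * partial_deriv i w x) + (\<Sum>i\<in>UNIV. partial_deriv i w x * partial_deriv i w x)"
    and x: "x \<in> S"
  shows "(\<Sum>i\<in>UNIV. partial_deriv i (partial_deriv i (partial_deriv j (partial_deriv k w))) x) =
    2 * partial_deriv j (partial_deriv k w) x
    + (\<Sum>i\<in>UNIV. (x $ i + 2 * partial_deriv i w x) * partial_deriv i (partial_deriv j (partial_deriv k w)) x)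
    + 2 * (\<Sum>i\<in>UNIV. partial_deriv i (partial_deriv j w) x * partial_deriv i (partial_deriv k w) x)"
proof -
  note sm = S(2) smooth_on_partial
  have d: "g differentiable (at y)" if "smooth_on S g" "y \<in> S" for g :: "real^'n \<Rightarrow> real" and y
    using smooth_on_differentiable that by blast
  have delta: "(\<Sum>i\<in>UNIV. (if i = m then 1 else 0) * g i) = g m" for g :: "'n \<Rightarrow> real" and m
    by (simp add: if_distrib[of "\<lambda>z. z * _"] cong: if_cong)
  note rules = partial_deriv_add partial_deriv_mult partial_deriv_sum partial_deriv_const partial_deriv_nth
    differentiable_add differentiable_mult differentiable_sum differentiable_const differentiable_nth
    d sm
  have E1: "(\<Sum>i\<in>UNIV. partial_deriv k (partial_deriv i (partial_deriv i w)) y) =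
      partial_deriv k w y + (\<Sum>i\<in>UNIV. y $ i * partial_deriv k (partial_deriv i w) y)
      + 2 * (\<Sum>i\<in>UNIV. partial_deriv i w y * partial_deriv k (partial_deriv i w) y)" if y: "y \<in> S" for y k
  proof -
    have "(\<Sum>i\<in>UNIV. partial_deriv k (partial_deriv i (partial_deriv i w)) y) =
        partial_deriv k (\<lambda>x. \<Sum>i\<in>UNIV. partial_deriv i (partial_deriv i w) x) y"
      using y by (simp add: rules)
    also have "\<dots> = partial_deriv k (\<lambda>x. l + (\<Sum>i\<in>UNIV. x $ i * partial_deriv i w x)
        + (\<Sum>i\<in>UNIV. partial_deriv i w x * partial_deriv i w x)) y"
      by (rule partial_deriv_cong[OF S(1) y eq])
    also have "\<dots> = (\<Sum>i\<in>UNIV. y $ i * partial_deriv k (partial_deriv i w) y + (if i = k then 1 else 0) * partial_deriv i w y)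
        + (\<Sum>i\<in>UNIV. partial_deriv i w y * partial_deriv k (partial_deriv i w) y
           + partial_deriv k (partial_deriv i w) y * partial_deriv i w y)"
      using y by (simp add: rules)
    finally show ?thesis
      unfolding sum.distrib delta by (simp add: mult.commute)
  qed
  have "(\<Sum>i\<in>UNIV. partial_deriv i (partial_deriv i (partial_deriv j (partial_deriv k w))) x) =
      (\<Sum>i\<in>UNIV. partial_deriv j (partial_deriv k (partial_deriv i (partial_deriv i w))) x)"
  proof (rule sum.cong[OF refl])
    fix i
    have "partial_deriv j (partial_deriv k (partial_deriv i (partial_deriv i w))) x
        = partial_deriv i (partial_deriv j (partial_deriv k (partial_deriv i w))) x"
      by (rule partial_deriv_rotate[OF S(1) _ x]) (simp add: sm)
    also have "\<dots> = partial_deriv i (partial_deriv i (partial_deriv j (partial_deriv k w))) x"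
      by (rule partial_deriv_cong[OF S(1) x partial_deriv_rotate[OF S]])
    finally show "partial_deriv i (partial_deriv i (partial_deriv j (partial_deriv k w))) x
        = partial_deriv j (partial_deriv k (partial_deriv i (partial_deriv i w))) x" by simp
  qed
  also have "\<dots> = partial_deriv j (\<lambda>y. \<Sum>i\<in>UNIV. partial_deriv k (partial_deriv i (partial_deriv i w)) y) x"
    using x by (simp add: rules)
  also have "\<dots> = partial_deriv j (\<lambda>y. partial_deriv k w y + (\<Sum>i\<in>UNIV. y $ i * partial_deriv k (partial_deriv i w) y)
      + 2 * (\<Sum>i\<in>UNIV. partial_deriv i w y * partial_deriv k (partial_deriv i w) y)) x"
    by (rule partial_deriv_cong[OF S(1) x E1])
  also have "\<dots> = partial_deriv j (partial_deriv k w) x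
      + (\<Sum>i\<in>UNIV. x $ i * partial_deriv j (partial_deriv k (partial_deriv i w)) x
          + (if i = j then 1 else 0) * partial_deriv k (partial_deriv i w) x)
      + 2 * (\<Sum>i\<in>UNIV. partial_deriv i w x * partial_deriv j (partial_deriv k (partial_deriv i w)) x
          + partial_deriv j (partial_deriv i w) x * partial_deriv k (partial_deriv i w) x)"
    using x by (simp add: rules)
  also have "\<dots> = 2 * partial_deriv j (partial_deriv k w) x
    + (\<Sum>i\<in>UNIV. (x $ i + 2 * partial_deriv i w x) * partial_deriv i (partial_deriv j (partial_deriv k w)) x)
    + 2 * (\<Sum>i\<in>UNIV. partial_deriv i (partial_deriv j w) x * partial_deriv i (partial_deriv k w) x)"
  proof -
    have c: "partial_deriv p (partial_deriv q w) x = partial_deriv q (partial_deriv p w) x" for p q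
      by (rule partial_deriv_commute[OF S(1) _ x]) (use S(2) in \<open>auto simp: smooth_on_def\<close>)
    have sumc: "(\<Sum>i\<in>UNIV. partial_deriv j (partial_deriv i w) x * partial_deriv k (partial_deriv i w) x)
        = (\<Sum>i\<in>UNIV. partial_deriv i (partial_deriv j w) x * partial_deriv i (partial_deriv k w) x)"
      by (rule sum.cong[OF refl]) (metis c)
    show ?thesis
      unfolding partial_deriv_rotate[OF S x] sum.distrib distrib_right distrib_left delta sumc c[of k j]
      by (simp add: sum_distrib_left mult.assoc)
  qed
  finally show ?thesis .
qed

text \<open>Along \<open>e + t *\<^sub>R r\<close> with the residual \<open>r\<close>, the form
  minus \<open>m\<close> times the squared norm is a quadratic polynomial in \<open>t\<close>,
  nonnegative and zero at \<open>t = 0\<close>. Its linear coefficient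
  \<open>2 * (r \<bullet> r)\<close> must vanish.\<close>

lemma minimizer_is_eigenvector:
  fixes A :: "real^'n::finite^'n"
  assumes sym: "transpose A = A" and min: "\<And>v. m * (v \<bullet> v) \<le> v \<bullet> (A *v v)"
    and e: "e \<bullet> (A *v e) = m * (e \<bullet> e)"
  shows "A *v e = m *\<^sub>R e"
proof -
  define r where "r = A *v e - m *\<^sub>R e"
  have s: "e \<bullet> (A *v r) = r \<bullet> (A *v e)"
    using sym by (metis dot_lmul_matrix inner_commute transpose_matrix_vector)
  have "0 + (2 * (r \<bullet> r)) * t + (r \<bullet> (A *v r) - m * (r \<bullet> r)) * t\<^sup>2 \<ge> 0" for t
    using min[of "e + t *\<^sub>R r"] e s
    by (simp add: matrix_vector_right_distrib matrix_vector_mult_scaleR inner_add_left inner_add_right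
        r_def inner_diff_left inner_diff_right inner_commute power2_eq_square algebra_simps)
  then have "2 * (r \<bullet> r) = 0"
    using jet2_local_min[OF jet2_quadratic[of 0 "2 * (r \<bullet> r)" "r \<bullet> (A *v r) - m * (r \<bullet> r)"]] by simp
  then show ?thesis by (simp add: r_def)
qed

text \<open>\<open>second_derivative_equation\<close> contracted with the constants
  \<open>e $ i * e $ j\<close>. Since \<open>e\<close> does not vary with the point, the operator
  passes through the sums, and the product of Hessians becomes the squared norm of
  \<open>hessian w x *v e\<close>.\<close>

lemma second_derivative_form_equation:
  fixes w :: "real^'n::finite \<Rightarrow> real"
  assumes S: "open S" "smooth_on S w"
    and eq: "\<And>x. x \<in> S \<Longrightarrow> (\<Sum>i\<in>UNIV. partial_deriv i (partial_deriv i w) x) =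
      l + (\<Sum>i\<in>UNIV. x $ i * partial_deriv i w x) + (\<Sum>i\<in>UNIV. partial_deriv i w x * partial_deriv i w x)"
    and x: "x \<in> S"
  obtains a d where
    "\<And>m. jet2 (\<lambda>t. e \<bullet> (hessian w (x + t *\<^sub>R axis m 1) *v e)) (a $ m) (d m)"
    "(\<Sum>m\<in>UNIV. d m) - (x + 2 *\<^sub>R gradient w x) \<bullet> a =
      2 * (e \<bullet> (hessian w x *v e)) + 2 * ((hessian w x *v e) \<bullet> (hessian w x *v e))"
proof -
  let ?P = "\<lambda>i j. partial_deriv j (partial_deriv i w)"
  define a :: "real^'n" where "a = (\<chi> m. \<Sum>i\<in>UNIV. e $ i * (\<Sum>j\<in>UNIV. e $ j * partial_deriv m (?P i j) x))"
  define d where "d = (\<lambda>m. \<Sum>i\<in>UNIV. e $ i * (\<Sum>j\<in>UNIV. e $ j * partial_deriv m (partial_deriv m (?P i j)) x))"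
  have sm: "smooth_on S (?P i j)" for i j using S(2) by (intro smooth_on_partial)
  have jet: "jet2 (\<lambda>t. e \<bullet> (hessian w (x + t *\<^sub>R axis m 1) *v e)) (a $ m) (d m)" for m
    unfolding inner_hessian_mult a_def d_def vec_lambda_beta
    by (intro jet2_sum jet2_cmult smooth_on_jet2_axis[OF S(1) sm x])
  have split: "(\<Sum>m\<in>UNIV. d m) - (x + 2 *\<^sub>R gradient w x) \<bullet> a =
      (\<Sum>i\<in>UNIV. e $ i * (\<Sum>j\<in>UNIV. e $ j * ((\<Sum>m\<in>UNIV. partial_deriv m (partial_deriv m (?P i j)) x)
        - (\<Sum>m\<in>UNIV. (x $ m + 2 * partial_deriv m w x) * partial_deriv m (?P i j) x))))"
  proof -
    have "(\<Sum>m\<in>UNIV. d m) = (\<Sum>i\<in>UNIV. \<Sum>j\<in>UNIV. \<Sum>m\<in>UNIV. e $ i * (e $ j * partial_deriv m (partial_deriv m (?P i j)) x))"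
      unfolding d_def sum_distrib_left
      by (subst sum.swap, rule sum.cong[OF refl], rule sum.swap)
    moreover have "(x + 2 *\<^sub>R gradient w x) \<bullet> a = (\<Sum>i\<in>UNIV. \<Sum>j\<in>UNIV. \<Sum>m\<in>UNIV.
        (x $ m + 2 * partial_deriv m w x) * (e $ i * (e $ j * partial_deriv m (?P i j) x)))"
      unfolding a_def inner_vec_def inner_real_def sum_distrib_left gradient_def vec_lambda_beta
        vector_add_component vector_scaleR_component real_scaleR_def
      by (subst sum.swap, rule sum.cong[OF refl], rule sum.swap)
    ultimately show ?thesis
      by (simp add: sum_distrib_left right_diff_distrib sum_subtractf mult_ac)
  qed
  have "(\<Sum>m\<in>UNIV. partial_deriv m (partial_deriv m (?P i j)) x)
        - (\<Sum>m\<in>UNIV. (x $ m + 2 * partial_deriv m w x) * partial_deriv m (?P i j) x)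
      = 2 * ?P i j x + 2 * (\<Sum>m\<in>UNIV. ?P j m x * ?P i m x)" for i j
    using second_derivative_equation[OF S eq x, of j i] by simp
  then have "(\<Sum>m\<in>UNIV. d m) - (x + 2 *\<^sub>R gradient w x) \<bullet> a =
      (\<Sum>i\<in>UNIV. e $ i * (\<Sum>j\<in>UNIV. e $ j * (2 * ?P i j x + 2 * (\<Sum>m\<in>UNIV. ?P j m x * ?P i m x))))"
    unfolding split by simp
  also have "\<dots> = 2 * (\<Sum>i\<in>UNIV. e $ i * (\<Sum>j\<in>UNIV. e $ j * ?P i j x))
      + 2 * (\<Sum>i\<in>UNIV. \<Sum>j\<in>UNIV. \<Sum>m\<in>UNIV. (?P i m x * e $ i) * (?P j m x * e $ j))"
    by (simp add: distrib_left sum.distrib sum_distrib_left mult_ac)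
  also have "(\<Sum>i\<in>UNIV. \<Sum>j\<in>UNIV. \<Sum>m\<in>UNIV. (?P i m x * e $ i) * (?P j m x * e $ j))
      = (\<Sum>i\<in>UNIV. \<Sum>m\<in>UNIV. \<Sum>j\<in>UNIV. (?P i m x * e $ i) * (?P j m x * e $ j))"
    by (rule sum.cong[OF refl], rule sum.swap)
  also have "\<dots> = (\<Sum>m\<in>UNIV. \<Sum>i\<in>UNIV. \<Sum>j\<in>UNIV. (?P i m x * e $ i) * (?P j m x * e $ j))"
    by (rule sum.swap)
  also have "\<dots> = (hessian w x *v e) \<bullet> (hessian w x *v e)"
    by (simp add: inner_vec_def matrix_vector_mult_def hessian_def sum_product)
  finally show ?thesis using that[OF jet] unfolding inner_hessian_mult by blast
qed

text \<open>The strong minimum principle is applied to the smallest Hessian eigenvalue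
  \<open>\<mu>\<close>. It need not be differentiable, but at each point the Hessian form in a fixed
  minimizing direction touches it from above and is smooth.\<close>

lemma nonneg_hessian_imp_positive:
  fixes w :: "real^'n::finite \<Rightarrow> real"
  assumes S: "open S" "connected S" "smooth_on S w"
    and eq: "\<And>x. x \<in> S \<Longrightarrow> (\<Sum>i\<in>UNIV. partial_deriv i (partial_deriv i w) x) =
      l + (\<Sum>i\<in>UNIV. x $ i * partial_deriv i w x) + (\<Sum>i\<in>UNIV. partial_deriv i w x * partial_deriv i w x)"
    and psd: "\<And>x v. x \<in> S \<Longrightarrow> 0 \<le> v \<bullet> (hessian w x *v v)"
    and x0: "x0 \<in> S" "\<And>v. v \<noteq> 0 \<Longrightarrow> 0 < v \<bullet> (hessian w x0 *v v)"
    and x1: "x1 \<in> S" and v: "v \<noteq> 0"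
  shows "0 < v \<bullet> (hessian w x1 *v v)"
proof (rule ccontr)
  assume "\<not> 0 < v \<bullet> (hessian w x1 *v v)"
  then have v0: "v \<bullet> (hessian w x1 *v v) = 0" using psd[OF x1, of v] by simp
  let ?K = "sphere (0::real^'n) 1"
  define \<mu> where "\<mu> = (\<lambda>x. INF e\<in>?K. e \<bullet> (hessian w x *v e))"
  have K: "compact ?K" "?K \<noteq> {}" by auto
  have cont2: "continuous_on S (partial_deriv j (partial_deriv i w))" for i j
    using S(3) by (intro smooth_on_continuous smooth_on_partial)
  have contH: "continuous_on (S \<times> ?K) (\<lambda>(x, e). e \<bullet> (hessian w x *v e))"
  proof -
    have "continuous_on (S \<times> ?K) (\<lambda>p. partial_deriv j (partial_deriv i w) (fst p))" for i j
      by (rule continuous_on_compose2[OF cont2 continuous_on_fst[OF continuous_on_id]]) auto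
    moreover have "continuous_on (S \<times> ?K) (\<lambda>p. snd p $ i)" for i
      by (intro continuous_on_component continuous_on_snd continuous_on_id)
    ultimately show ?thesis
      unfolding inner_hessian_mult split_beta
      by (intro continuous_on_sum continuous_on_mult)
  qed
  have cont\<mu>: "continuous_on S \<mu>"
    unfolding \<mu>_def by (rule continuous_on_INF_compact[OF K contH])
  have att: "\<exists>e\<in>?K. \<mu> x = e \<bullet> (hessian w x *v e) \<and>
      (\<forall>e'\<in>?K. e \<bullet> (hessian w x *v e) \<le> e' \<bullet> (hessian w x *v e'))" if "x \<in> S" for x
  proof -
    have "continuous_on ?K (\<lambda>e. e \<bullet> (hessian w x *v e))"
      unfolding inner_hessian_mult
      by (intro continuous_on_sum continuous_on_mult continuous_on_component continuous_on_const continuous_on_id)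
    then show ?thesis unfolding \<mu>_def by (rule compact_INF_attained[OF K])
  qed
  have \<mu>_le: "\<mu> x \<le> e \<bullet> (hessian w x *v e)" if x: "x \<in> S" and e: "norm e = 1" for x e
  proof -
    obtain e' where "\<mu> x = e' \<bullet> (hessian w x *v e')"
        "\<forall>e\<in>?K. e' \<bullet> (hessian w x *v e') \<le> e \<bullet> (hessian w x *v e)"
      using att[OF x] by blast
    then show ?thesis using e by simp
  qed
  have nonneg: "\<mu> x \<ge> 0" if x: "x \<in> S" for x
  proof -
    obtain e where "\<mu> x = e \<bullet> (hessian w x *v e)" using att[OF x] by blast
    then show ?thesis using psd[OF x] by simp
  qed
  have "\<mu> x1 \<le> (v /\<^sub>R norm v) \<bullet> (hessian w x1 *v (v /\<^sub>R norm v))"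
    by (rule \<mu>_le[OF x1]) (use v in simp)
  then have \<mu>1: "\<mu> x1 = 0"
    using nonneg[OF x1] v0 by (simp add: matrix_vector_mult_scaleR)
  have grad: "continuous_on S (\<lambda>x. x + 2 *\<^sub>R gradient w x)"
    unfolding gradient_def using S(3)
    by (intro continuous_intros continuous_on_vec_lambda smooth_on_continuous smooth_on_partial)
  \<comment> \<open>The bound \<open>2 * \<mu> + 2 * \<mu>\<^sup>2\<close> is read as linear in
    \<open>\<mu>\<close> with the continuous coefficient \<open>2 + 2 * \<mu>\<close>, as
    \<open>strong_minimum\<close> demands.\<close>
  have touch: "\<exists>F a d. F x = \<mu> x \<and> (\<forall>\<^sub>F y in nhds x. \<mu> y \<le> F y) \<and>
      (\<forall>i. jet2 (\<lambda>t. F (x + t *\<^sub>R axis i 1)) (a $ i) (d i)) \<and>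
      (\<Sum>i\<in>UNIV. d i) - (x + 2 *\<^sub>R gradient w x) \<bullet> a \<le> (2 + 2 * \<mu> x) * \<mu> x" if x: "x \<in> S" for x
  proof -
    obtain e where e: "e \<in> ?K" "\<mu> x = e \<bullet> (hessian w x *v e)"
      using att[OF x] by blast
    have ee: "e \<bullet> e = 1" using e(1) by (simp flip: power2_norm_eq_inner)
    have "\<mu> x * (v \<bullet> v) \<le> v \<bullet> (hessian w x *v v)" for v
    proof (cases "v = 0")
      case False
      then have "\<mu> x \<le> (v /\<^sub>R norm v) \<bullet> (hessian w x *v (v /\<^sub>R norm v))"
        by (intro \<mu>_le[OF x]) simp
      also have "\<dots> = (v \<bullet> (hessian w x *v v)) / (v \<bullet> v)"
        by (simp add: matrix_vector_mult_scaleR divide_inverse power2_eq_square flip: power2_norm_eq_inner)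
      finally show ?thesis using False by (simp add: field_simps)
    qed simp
    \<comment> \<open>The eigenvector equation turns the squared norm of
      \<open>hessian w x *v e\<close> into \<open>(\<mu> x)\<^sup>2\<close>.\<close>
    then have eig: "hessian w x *v e = \<mu> x *\<^sub>R e"
      using transpose_hessian[OF S(1,3) x] e(2) ee by (intro minimizer_is_eigenvector) auto
    obtain a d where ad: "\<And>m. jet2 (\<lambda>t. e \<bullet> (hessian w (x + t *\<^sub>R axis m 1) *v e)) (a $ m) (d m)"
      "(\<Sum>m\<in>UNIV. d m) - (x + 2 *\<^sub>R gradient w x) \<bullet> a =
        2 * (e \<bullet> (hessian w x *v e)) + 2 * ((hessian w x *v e) \<bullet> (hessian w x *v e))"
      using second_derivative_form_equation[OF S(1,3) eq x] by blast
    have "\<forall>\<^sub>F y in nhds x. \<mu> y \<le> e \<bullet> (hessian w y *v e)"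
      using eventually_nhds_in_open[OF S(1) x] by eventually_elim (rule \<mu>_le, use e(1) in auto)
    then show ?thesis using e(2) ad
      by (intro exI[of _ "\<lambda>y. e \<bullet> (hessian w y *v e)"] exI[of _ a] exI[of _ d])
         (auto simp: eig ee algebra_simps)
  qed
  \<comment> \<open>The zero of \<open>\<mu>\<close> at \<open>x1\<close> spreads to
    \<open>x0\<close>, where a minimizing unit vector contradicts positivity.\<close>
  have "\<mu> x0 = 0"
    by (rule strong_minimum[OF S(1,2) cont\<mu> nonneg grad _ touch x1 \<mu>1 x0(1)])
       (auto intro!: continuous_intros cont\<mu>)
  then obtain e where "e \<in> ?K" "e \<bullet> (hessian w x0 *v e) = 0"
    using att[OF x0(1)] by auto
  moreover from this have "e \<noteq> 0" by auto
  ultimately show False using x0(2)[of e] by simp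
qed

section \<open>Subsolutions vanishing on the boundary\<close>

text \<open>Concavity of the distance to the complement, as an affine majorant touching at
  \<open>x0\<close>. \<open>\<nu>\<close> is an outer unit normal at a nearest boundary point
  \<open>z\<close>: from \<open>x\<close> one can move along \<open>\<nu>\<close> by any length
  below the distance and stay in \<open>S\<close>, hence below the hyperplane.\<close>

lemma infdist_supporting_hyperplane:
  fixes S :: "'a::euclidean_space set"
  assumes "open S" "convex S" "S \<noteq> UNIV" "x0 \<in> S"
  obtains \<nu> k where "norm \<nu> = 1" "infdist x0 (- S) = k - \<nu> \<bullet> x0"
    "\<And>x. x \<in> S \<Longrightarrow> infdist x (- S) \<le> k - \<nu> \<bullet> x"
proof -
  have ne: "- S \<noteq> {}" "closed (- S)" using assms by auto
  obtain z where z: "z \<in> - S" "infdist x0 (- S) = dist x0 z"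
    using infdist_attains_inf[OF ne(2,1)] by blast
  obtain a b where ab: "a \<noteq> 0" "\<forall>x\<in>S. a \<bullet> x \<le> b" "\<forall>x\<in>{z}. a \<bullet> x \<ge> b"
    using separating_hyperplane_sets[of S "{z}"] assms z(1) by auto
  define \<nu> where "\<nu> = a /\<^sub>R norm a"
  have \<nu>: "norm \<nu> = 1" using ab(1) by (simp add: \<nu>_def)
  have sup: "\<nu> \<bullet> x \<le> \<nu> \<bullet> z" if "x \<in> S" for x
  proof -
    have "a \<bullet> x \<le> a \<bullet> z" using ab(2,3) that by force
    then show ?thesis using ab(1) by (simp add: \<nu>_def)
  qed
  have le: "infdist x (- S) \<le> \<nu> \<bullet> z - \<nu> \<bullet> x" if "x \<in> S" for x
  proof (rule dense_le)
    fix s assume s: "s < infdist x (- S)"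
    show "s \<le> \<nu> \<bullet> z - \<nu> \<bullet> x"
    proof (cases "s \<ge> 0")
      case True
      have "x + s *\<^sub>R \<nu> \<in> S"
      proof (rule ccontr)
        assume "x + s *\<^sub>R \<nu> \<notin> S"
        then have "infdist x (- S) \<le> dist x (x + s *\<^sub>R \<nu>)" by (intro infdist_le) auto
        also have "\<dots> = s" using \<nu> True by (simp add: dist_norm)
        finally show False using s by simp
      qed
      from sup[OF this] have "\<nu> \<bullet> x + s * (\<nu> \<bullet> \<nu>) \<le> \<nu> \<bullet> z" by (simp add: inner_add_right)
      moreover have "\<nu> \<bullet> \<nu> = 1" using \<nu> by (simp flip: power2_norm_eq_inner)
      ultimately show ?thesis by simp
    next
      case False
      then show ?thesis using sup[OF that] by simp
    qed
  qed
  have "\<nu> \<bullet> z - \<nu> \<bullet> x0 \<le> dist x0 z"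
    using norm_cauchy_schwarz[of \<nu> "z - x0"] \<nu> by (simp add: inner_diff_right dist_norm norm_minus_commute)
  then have "infdist x0 (- S) = \<nu> \<bullet> z - \<nu> \<bullet> x0" using le[OF assms(4)] z(2) by simp
  then show ?thesis using that[of \<nu> "\<nu> \<bullet> z"] \<nu> le by blast
qed

text \<open>As \<open>u\<close> vanishes on the boundary, \<open>v / u\<close> need not attain a
  maximum on \<open>\<Omega>\<close>. \<open>C\<close> is its maximum over the compact set
  \<open>K\<close> away from the boundary, and the barrier extends \<open>v \<le> C * u\<close> to
  the remaining strip.\<close>

lemma subsolution_le_multiple:
  fixes \<Omega> :: "(real^'n::finite) set" and u v :: "real^'n \<Rightarrow> real"
  assumes \<Omega>: "open \<Omega>" "bounded \<Omega>" "convex \<Omega>" "\<Omega> \<noteq> {}"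
    and u: "smooth_on \<Omega> u" "continuous_on UNIV U" "\<And>x. x \<in> \<Omega> \<Longrightarrow> U x = u x" "\<And>x. x \<notin> \<Omega> \<Longrightarrow> U x = 0"
    and upos: "\<And>x. x \<in> \<Omega> \<Longrightarrow> u x > 0"
    and eq: "\<And>x. x \<in> \<Omega> \<Longrightarrow> - laplacian u x + x \<bullet> gradient u x = l * u x"
    and v: "continuous_on UNIV v" "\<And>x. x \<notin> \<Omega> \<Longrightarrow> v x = 0"
    and touch: "\<And>x. x \<in> \<Omega> \<Longrightarrow> \<exists>Q a d. Q x = v x \<and> (\<forall>\<^sub>F y in nhds x. Q y \<le> v y) \<and>
      (\<forall>i. jet2 (\<lambda>t. Q (x + t *\<^sub>R axis i 1)) (a $ i) (d i)) \<and>
      (\<Sum>i\<in>UNIV. d i) - x \<bullet> a \<ge> - l * v x"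
  shows "\<exists>C. (\<forall>x\<in>\<Omega>. v x \<le> C * u x) \<and> (\<exists>x\<in>\<Omega>. v x = C * u x)"
proof -
  obtain R where R: "R > 0" "\<And>x. x \<in> \<Omega> \<Longrightarrow> norm x \<le> R"
    using \<Omega>(2) unfolding bounded_pos by blast
  have nU: "\<Omega> \<noteq> UNIV" using \<Omega>(2) by auto
  then have ne: "- \<Omega> \<noteq> {}" "closed (- \<Omega>)" using \<Omega>(1) by auto
  define dd where "dd = (\<lambda>x. infdist x (- \<Omega>))"
  have dd_out: "dd x = 0" if "x \<notin> \<Omega>" for x using that by (simp add: dd_def)
  have dd_in: "dd x > 0" if "x \<in> \<Omega>" for x
    using that ne in_closed_iff_infdist_zero[OF ne(2,1), of x] infdist_nonneg[of x "- \<Omega>"] by (simp add: dd_def less_le)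
  have dd_cont: "continuous_on X dd" for X
    unfolding dd_def by (intro continuous_on_infdist continuous_on_id)
  obtain p where p: "p \<in> \<Omega>" using \<Omega>(4) by blast
  \<comment> \<open>The bound \<open>dd p\<close> keeps \<open>K\<close> nonempty. The other one
    makes \<open>1 / \<delta>\<close> exceed \<open>R + 2 * \<bar>l\<bar>\<close>, the size of the
    lower-order terms, and gives \<open>\<delta> \<le> 1\<close>, hence
    \<open>\<psi> \<le> 2\<close>.\<close>
  define \<delta> where "\<delta> = min (dd p) (1 / (R + 2 * \<bar>l\<bar> + 1))"
  have \<delta>: "\<delta> > 0" "\<delta> \<le> dd p" using dd_in[OF p] R(1) by (auto simp: \<delta>_def)
  have \<delta>1: "R + 2 * \<bar>l\<bar> + 1 \<le> 1 / \<delta>"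
  proof -
    have "\<delta> \<le> 1 / (R + 2 * \<bar>l\<bar> + 1)" by (simp add: \<delta>_def)
    then show ?thesis using \<delta>(1) R(1) by (simp add: field_simps)
  qed
  have "1 * \<delta> \<le> (R + 2 * \<bar>l\<bar> + 1) * \<delta>" using R(1) \<delta>(1) by (intro mult_right_mono) auto
  also have "\<dots> \<le> 1" using \<delta>1 \<delta>(1) by (simp add: field_simps)
  finally have \<delta>2: "\<delta> \<le> 1" by simp
  define K where "K = {x \<in> closure \<Omega>. \<delta> \<le> dd x}"
  have KO: "K \<subseteq> \<Omega>" using dd_out \<delta>(1) by (force simp: K_def)
  have "closed K" unfolding K_def
    by (intro continuous_on_closed_Collect_le continuous_on_const dd_cont closed_closure)
  moreover have "bounded K" using \<Omega>(2) KO bounded_subset by blast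
  ultimately have cK: "compact K" by (simp add: compact_eq_bounded_closed)
  have neK: "K \<noteq> {}" using p \<delta>(2) closure_subset by (auto simp: K_def)
  have "\<forall>x\<in>K. u x \<noteq> 0" using KO upos by force
  then have "continuous_on K (\<lambda>x. v x / u x)"
    by (intro continuous_on_divide continuous_on_subset[OF v(1) subset_UNIV]
        continuous_on_subset[OF smooth_on_continuous[OF u(1)] KO])
  from continuous_attains_sup[OF cK neK this] obtain x1 where
    x1: "x1 \<in> K" "\<And>x. x \<in> K \<Longrightarrow> v x / u x \<le> v x1 / u x1" by blast
  define C where "C = v x1 / u x1"
  have CK: "v x \<le> C * u x" if "x \<in> K" for x
  proof -
    have "u x > 0" using that KO upos by blast
    then show ?thesis using x1(2)[OF that] by (simp add: C_def divide_le_eq)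
  qed
  \<comment> \<open>On the strip of width \<open>\<delta>\<close> at the boundary, \<open>\<psi>(dd)\<close> is a positive strict supersolution: \<open>\<psi>'' = - 1 / \<delta>\<close>
      dominates the lower-order terms. At a point, \<open>dd\<close> is replaced by an affine function lying above it.\<close>
  define \<psi> where "\<psi> = (\<lambda>s. 1 + s - s\<^sup>2 / (2 * \<delta>))"
  have \<psi>_cont: "continuous_on UNIV \<psi>"
    unfolding \<psi>_def using \<delta>(1) by (intro continuous_intros) auto
  have \<psi>_mono: "\<psi> s \<le> \<psi> t" if "s \<le> t" "t \<le> \<delta>" "0 \<le> s" for s t
  proof -
    have "(t - s) * (t + s) \<le> (t - s) * (2 * \<delta>)" using that by (intro mult_left_mono) auto
    then have "t\<^sup>2 - s\<^sup>2 \<le> (t - s) * (2 * \<delta>)"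
      by (simp add: power2_eq_square algebra_simps)
    then have "(t\<^sup>2 - s\<^sup>2) / (2 * \<delta>) \<le> t - s"
      using \<delta>(1) by (simp only: pos_divide_le_eq)
    then show ?thesis by (simp add: \<psi>_def diff_divide_distrib)
  qed
  have \<psi>_bounds: "1 \<le> \<psi> s" "\<psi> s \<le> 2" if "0 \<le> s" "s \<le> \<delta>" for s
  proof -
    have "0 \<le> s\<^sup>2 / (2 * \<delta>)" using \<delta>(1) by simp
    then show "\<psi> s \<le> 2" using that \<delta>2 unfolding \<psi>_def by linarith
    show "1 \<le> \<psi> s" using \<psi>_mono[of 0 s] that by (simp add: \<psi>_def)
  qed
  have main: "v x2 \<le> C * u x2" if "x2 \<in> \<Omega>" for x2
  proof (rule ccontr)
    assume x2: "\<not> v x2 \<le> C * u x2"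
    define T where "T = {x \<in> closure \<Omega>. dd x \<le> \<delta>}"
    have "closed T" unfolding T_def
      by (intro continuous_on_closed_Collect_le continuous_on_const dd_cont closed_closure)
    moreover have "bounded T" using \<Omega>(2) bounded_closure unfolding T_def by (auto intro: bounded_subset)
    ultimately have "compact T" by (simp add: compact_eq_bounded_closed)
    moreover have x2T: "x2 \<in> T"
    proof -
      have "x2 \<notin> K" "x2 \<in> closure \<Omega>" using x2 CK that closure_subset by blast+
      then show ?thesis by (simp add: T_def K_def)
    qed
    \<comment> \<open>If \<open>v > C * u\<close> somewhere in the strip, \<open>k\<close> has a
      positive maximum \<open>M\<close> there, so \<open>v - C * U\<close> lies below
      \<open>M * \<psi> (dd x)\<close> and touches it at a point \<open>x0\<close>. Off
      \<open>\<Omega>\<close> the numerator is 0, so \<open>x0\<close> lies inside.\<close>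
    define k where "k = (\<lambda>x. (v x - C * U x) / \<psi> (dd x))"
    have \<psi>T: "1 \<le> \<psi> (dd x)" "\<psi> (dd x) \<le> 2" if "x \<in> T" for x
      using \<psi>_bounds[of "dd x"] that infdist_nonneg[of x "- \<Omega>"] by (auto simp: T_def dd_def)
    have "\<forall>x\<in>T. \<psi> (dd x) \<noteq> 0" using \<psi>T by force
    then have "continuous_on T k" unfolding k_def
      by (intro continuous_on_divide continuous_on_diff continuous_on_mult continuous_on_const
          continuous_on_subset[OF v(1) subset_UNIV] continuous_on_subset[OF u(2) subset_UNIV]
          continuous_on_compose2[OF \<psi>_cont dd_cont] subset_UNIV)
    ultimately have "\<exists>x\<in>T. \<forall>y\<in>T. k y \<le> k x"
      using x2T by (intro continuous_attains_sup) auto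
    then obtain x0 where x0: "x0 \<in> T" "\<And>x. x \<in> T \<Longrightarrow> k x \<le> k x0"
      by blast
    define M where "M = k x0"
    have "k x2 > 0" using x2 that u(3) \<psi>T[OF x2T] by (simp add: k_def)
    then have M: "M > 0" using x0(2)[OF x2T] by (simp add: M_def)
    have x0O: "x0 \<in> \<Omega>"
    proof (rule ccontr)
      assume "x0 \<notin> \<Omega>"
      then show False using M v(2) u(4) by (simp add: M_def k_def)
    qed
    have vx0: "v x0 - C * u x0 = M * \<psi> (dd x0)"
      using \<psi>T[OF x0(1)] u(3)[OF x0O] by (simp add: M_def k_def)
    then have "v x0 - C * u x0 > 0" using M \<psi>T[OF x0(1)] by simp
    \<comment> \<open>On the inner edge of the strip \<open>CK\<close> rules out a positive
      difference. The strict inequality lets the affine majorant of \<open>dd\<close> stay below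
      \<open>\<delta>\<close> near \<open>x0\<close>, in the range where \<open>\<psi>\<close>
      increases.\<close>
    then have dx0: "dd x0 < \<delta>" using CK[of x0] x0(1) by (force simp: T_def K_def)
    obtain \<nu> c where \<nu>: "norm \<nu> = 1" "dd x0 = c - \<nu> \<bullet> x0" "\<And>x. x \<in> \<Omega> \<Longrightarrow> dd x \<le> c - \<nu> \<bullet> x"
      using infdist_supporting_hyperplane[OF \<Omega>(1,3) nU x0O] unfolding dd_def by metis
    obtain Q a d where Q: "Q x0 = v x0" "\<forall>\<^sub>F y in nhds x0. Q y \<le> v y"
      and jet: "\<And>i. jet2 (\<lambda>t. Q (x0 + t *\<^sub>R axis i 1)) (a $ i) (d i)"
      and sub: "(\<Sum>i\<in>UNIV. d i) - x0 \<bullet> a \<ge> - l * v x0"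
      using touch[OF x0O] by blast
    \<comment> \<open>\<open>Q\<close> stands for \<open>v\<close> and the affine majorant for
      \<open>dd\<close>: both changes can only increase the difference near \<open>x0\<close> and
      leave it 0 at \<open>x0\<close>, where \<open>G\<close> thus has a local minimum.\<close>
    define G where "G = (\<lambda>x. (M * \<psi> (c - \<nu> \<bullet> x) + C * u x) - Q x)"
    have G0: "G x0 = 0" using vx0 Q(1) \<nu>(2) by (simp add: G_def)
    have "open {x. c - \<nu> \<bullet> x < \<delta>}"
      by (intro open_Collect_less continuous_intros)
    then have "\<forall>\<^sub>F y in nhds x0. c - \<nu> \<bullet> y < \<delta>"
      using eventually_nhds_in_open[of "{x. c - \<nu> \<bullet> x < \<delta>}" x0] dx0 \<nu>(2) by simp
    then have ev: "\<forall>\<^sub>F y in nhds x0. G x0 \<le> G y"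
      using Q(2) eventually_nhds_in_open[OF \<Omega>(1) x0O]
    proof eventually_elim
      case (elim y)
      have dy: "dd y \<le> c - \<nu> \<bullet> y" "dd y > 0" using \<nu>(3) dd_in elim by auto
      then have yT: "y \<in> T" using elim closure_subset[of \<Omega>] by (auto simp: T_def)
      have "(v y - C * u y) / \<psi> (dd y) \<le> M"
        using x0(2)[OF yT] u(3) elim by (simp add: k_def M_def)
      then have "v y - C * u y \<le> M * \<psi> (dd y)" using \<psi>T[OF yT] by (simp add: divide_le_eq)
      also have "\<dots> \<le> M * \<psi> (c - \<nu> \<bullet> y)"
        using M dy elim by (intro mult_left_mono \<psi>_mono) auto
      finally show ?case using elim G0 by (simp add: G_def)
    qed
    let ?g = "\<lambda>i. - \<nu> $ i * (1 - dd x0 / \<delta>)"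
    have j\<psi>: "jet2 (\<lambda>t. \<psi> (c - \<nu> \<bullet> (x0 + t *\<^sub>R axis i 1))) (?g i) (- (\<nu> $ i)\<^sup>2 / \<delta>)" for i
    proof -
      have "\<psi> (c - \<nu> \<bullet> (x0 + t *\<^sub>R axis i 1)) = \<psi> (dd x0) + ?g i * t + (- (\<nu> $ i)\<^sup>2 / (2 * \<delta>)) * t\<^sup>2" for t
        using \<delta>(1) unfolding \<nu>(2)
        by (simp add: \<psi>_def inner_add_right inner_axis power2_eq_square field_simps)
      then show ?thesis
        using jet2_quadratic[of "\<psi> (dd x0)" "?g i" "- (\<nu> $ i)\<^sup>2 / (2 * \<delta>)"] by simp
    qed
    have min: "M * ?g i + C * partial_deriv i u x0 - a $ i = 0 \<and>
        M * (- (\<nu> $ i)\<^sup>2 / \<delta>) + C * partial_deriv i (partial_deriv i u) x0 - d i \<ge> 0" for i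
      by (rule jet2_local_min[OF jet2_diff[OF jet2_add[OF jet2_cmult[OF j\<psi>]
            jet2_cmult[OF smooth_on_jet2_axis[OF \<Omega>(1) u(1) x0O]]] jet]])
         (use eventually_nhds_line[OF ev, of "axis i 1"] in \<open>simp add: G_def\<close>)
    have "a = (- M * (1 - dd x0 / \<delta>)) *\<^sub>R \<nu> + C *\<^sub>R gradient u x0"
      using min by (simp add: vec_eq_iff gradient_def algebra_simps)
    then have xa: "x0 \<bullet> a = - M * (1 - dd x0 / \<delta>) * (x0 \<bullet> \<nu>) + C * (x0 \<bullet> gradient u x0)"
      by (simp add: inner_diff_right)
    have "(\<Sum>i\<in>UNIV. d i) \<le> (\<Sum>i\<in>UNIV. M * (- (\<nu> $ i)\<^sup>2 / \<delta>) + C * partial_deriv i (partial_deriv i u) x0)"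
      using min by (intro sum_mono) (simp add: algebra_simps)
    also have "\<dots> = - M / \<delta> * (\<Sum>i\<in>UNIV. (\<nu> $ i)\<^sup>2) + C * laplacian u x0"
      by (simp add: sum.distrib laplacian_def sum_distrib_left sum_subtractf sum_negf)
    also have "(\<Sum>i\<in>UNIV. (\<nu> $ i)\<^sup>2) = (norm \<nu>)\<^sup>2"
      unfolding power2_norm_eq_inner inner_vec_def by (simp add: power2_eq_square)
    finally have "- l * v x0 \<le> - M / \<delta> + C * (laplacian u x0 - x0 \<bullet> gradient u x0)
        + M * (1 - dd x0 / \<delta>) * (x0 \<bullet> \<nu>)"
      using sub xa \<nu>(1) by (simp add: algebra_simps)
    also have "laplacian u x0 - x0 \<bullet> gradient u x0 = - l * u x0" using eq[OF x0O] by simp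
    finally have "M / \<delta> \<le> l * (v x0 - C * u x0) + M * (1 - dd x0 / \<delta>) * (x0 \<bullet> \<nu>)"
      by (simp add: algebra_simps)
    then have "M * (1 / \<delta>) \<le> M * (l * \<psi> (dd x0) + (1 - dd x0 / \<delta>) * (x0 \<bullet> \<nu>))"
      unfolding vx0 by (simp add: algebra_simps)
    then have "1 / \<delta> \<le> l * \<psi> (dd x0) + (1 - dd x0 / \<delta>) * (x0 \<bullet> \<nu>)"
      using M by (simp only: mult_le_cancel_left_pos)
    \<comment> \<open>The bounds are \<open>\<psi> \<le> 2\<close>, the slope
      \<open>1 - dd x0 / \<delta>\<close> of \<open>\<psi>\<close> in the interval from 0 to 1, and
      \<open>\<bar>x0 \<bullet> \<nu>\<bar> \<le> R\<close>.\<close>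
    also have "\<dots> \<le> \<bar>l\<bar> * 2 + 1 * R"
    proof (rule add_mono)
      have "l * \<psi> (dd x0) \<le> \<bar>l\<bar> * \<psi> (dd x0)" using \<psi>T[OF x0(1)] by (intro mult_right_mono) auto
      also have "\<dots> \<le> \<bar>l\<bar> * 2" using \<psi>T[OF x0(1)] by (intro mult_left_mono) auto
      finally show "l * \<psi> (dd x0) \<le> \<bar>l\<bar> * 2" .
      have 1: "0 \<le> 1 - dd x0 / \<delta>" "1 - dd x0 / \<delta> \<le> 1"
        using dx0 dd_in[OF x0O] \<delta>(1) by (auto simp: field_simps)
      have "\<bar>x0 \<bullet> \<nu>\<bar> \<le> R" using Cauchy_Schwarz_ineq2[of x0 \<nu>] \<nu>(1) R(2)[OF x0O] by simp
      then have "(1 - dd x0 / \<delta>) * (x0 \<bullet> \<nu>) \<le> (1 - dd x0 / \<delta>) * R"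
        using 1 by (intro mult_left_mono) auto
      also have "\<dots> \<le> 1 * R" using 1 R(1) by (intro mult_right_mono) auto
      finally show "(1 - dd x0 / \<delta>) * (x0 \<bullet> \<nu>) \<le> 1 * R" .
    qed
    finally show False using \<delta>1 by simp
  qed
  have x1O: "x1 \<in> \<Omega>" using x1(1) KO by blast
  then have "v x1 = C * u x1" using upos[OF x1O] by (simp add: C_def)
  then show ?thesis using x1O main by blast
qed

text \<open>\<open>C * u - v\<close> is nonnegative with a zero in \<open>\<Omega>\<close>, and
  \<open>C * u - Q\<close> touches it from above. The strong minimum principle applies with drift
  \<open>x\<close> and coefficient \<open>- l\<close>.\<close>

lemma subsolution_eq_multiple:
  fixes \<Omega> :: "(real^'n::finite) set" and u v :: "real^'n \<Rightarrow> real"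
  assumes \<Omega>: "open \<Omega>" "bounded \<Omega>" "convex \<Omega>" "\<Omega> \<noteq> {}"
    and u: "smooth_on \<Omega> u" "continuous_on UNIV U" "\<And>x. x \<in> \<Omega> \<Longrightarrow> U x = u x" "\<And>x. x \<notin> \<Omega> \<Longrightarrow> U x = 0"
    and upos: "\<And>x. x \<in> \<Omega> \<Longrightarrow> u x > 0"
    and eq: "\<And>x. x \<in> \<Omega> \<Longrightarrow> - laplacian u x + x \<bullet> gradient u x = l * u x"
    and v: "continuous_on UNIV v" "\<And>x. x \<notin> \<Omega> \<Longrightarrow> v x = 0"
    and touch: "\<And>x. x \<in> \<Omega> \<Longrightarrow> \<exists>Q a d. Q x = v x \<and> (\<forall>\<^sub>F y in nhds x. Q y \<le> v y) \<and>
      (\<forall>i. jet2 (\<lambda>t. Q (x + t *\<^sub>R axis i 1)) (a $ i) (d i)) \<and>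
      (\<Sum>i\<in>UNIV. d i) - x \<bullet> a \<ge> - l * v x"
  shows "\<exists>C. \<forall>x\<in>\<Omega>. v x = C * u x"
proof -
  obtain C x1 where C: "x1 \<in> \<Omega>" "\<And>x. x \<in> \<Omega> \<Longrightarrow> v x \<le> C * u x" "v x1 = C * u x1"
    using subsolution_le_multiple[OF assms] by auto
  define f where "f = (\<lambda>x. C * u x - v x)"
  have "f x = 0" if "x \<in> \<Omega>" for x
  proof (rule strong_minimum[of \<Omega> f "\<lambda>x. x" "\<lambda>x. - l" x1 x])
    show "open \<Omega>" "connected \<Omega>" "x \<in> \<Omega>" "x1 \<in> \<Omega>" "f x1 = 0"
      using \<Omega> convex_connected that C by (auto simp: f_def)
    show "continuous_on \<Omega> f" unfolding f_def
      by (intro continuous_intros smooth_on_continuous[OF u(1)] continuous_on_subset[OF v(1)]) simp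
    show "0 \<le> f x" if "x \<in> \<Omega>" for x using C(2)[OF that] by (simp add: f_def)
    show "continuous_on \<Omega> (\<lambda>x. x)" "continuous_on \<Omega> (\<lambda>x. - l)" by (intro continuous_intros)+
    fix x assume x: "x \<in> \<Omega>"
    obtain Q a d where Q: "Q x = v x" "\<forall>\<^sub>F y in nhds x. Q y \<le> v y"
      and jet: "\<And>i. jet2 (\<lambda>t. Q (x + t *\<^sub>R axis i 1)) (a $ i) (d i)"
      and sub: "(\<Sum>i\<in>UNIV. d i) - x \<bullet> a \<ge> - l * v x"
      using touch[OF x] by blast
    define a' where "a' = C *\<^sub>R gradient u x - a"
    define d' where "d' = (\<lambda>i. C * partial_deriv i (partial_deriv i u) x - d i)"
    have "jet2 (\<lambda>t. C * u (x + t *\<^sub>R axis i 1) - Q (x + t *\<^sub>R axis i 1)) (a' $ i) (d' i)" for i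
      using jet2_diff[OF jet2_cmult[OF smooth_on_jet2_axis[OF \<Omega>(1) u(1) x]] jet, of C i]
      by (simp add: a'_def d'_def gradient_def)
    moreover have "(\<Sum>i\<in>UNIV. d' i) - x \<bullet> a' \<le> - l * f x"
    proof -
      have "(\<Sum>i\<in>UNIV. d' i) - x \<bullet> a'
          = C * (laplacian u x - x \<bullet> gradient u x) - ((\<Sum>i\<in>UNIV. d i) - x \<bullet> a)"
        by (simp add: d'_def a'_def sum_subtractf laplacian_def sum_distrib_left inner_diff_right right_diff_distrib)
      also have "laplacian u x - x \<bullet> gradient u x = - l * u x" using eq[OF x] by simp
      finally show ?thesis using sub by (simp add: f_def algebra_simps)
    qed
    moreover have "\<forall>\<^sub>F y in nhds x. f y \<le> C * u y - Q y"
      using Q(2) by eventually_elim (simp add: f_def)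
    ultimately show "\<exists>F a d. F x = f x \<and> (\<forall>\<^sub>F y in nhds x. f y \<le> F y) \<and>
      (\<forall>i. jet2 (\<lambda>t. F (x + t *\<^sub>R axis i 1)) (a $ i) (d i)) \<and>
      (\<Sum>i\<in>UNIV. d i) - x \<bullet> a \<le> - l * f x"
      using Q(1) by (intro exI[of _ "\<lambda>y. C * u y - Q y"] exI[of _ a'] exI[of _ d']) (auto simp: f_def)
  qed
  then show ?thesis by (intro exI[of _ C]) (simp add: f_def)
qed

section \<open>The midpoint supremum\<close>

text \<open>A supremum written as a negated \<open>INF\<close>, to which the lemmas on compact
  infima apply. \<open>D\<close> will exceed the norms of all points of \<open>\<Omega>\<close>.
  Log-concavity will follow from equality of this function with \<open>U\<close> on
  \<open>\<Omega>\<close>.\<close>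

definition midpoint_sup :: "real \<Rightarrow> (real^'n::finite \<Rightarrow> real) \<Rightarrow> real^'n \<Rightarrow> real" where
  "midpoint_sup D U m = - (INF y\<in>cball 0 D. - sqrt (U (m + y) * U (m - y)))"

lemma midpoint_sup_continuous:
  fixes U :: "real^'n::finite \<Rightarrow> real"
  assumes "continuous_on UNIV U" "D \<ge> 0"
  shows "continuous_on UNIV (midpoint_sup D U)"
proof -
  have "continuous_on (UNIV \<times> cball (0::real^'n) D) (\<lambda>(x, y). - sqrt (U (x + y) * U (x - y)))"
    unfolding split_beta
    by (intro continuous_on_minus continuous_on_real_sqrt continuous_on_mult
        continuous_on_compose2[OF assms(1)] continuous_intros) auto
  then have "continuous_on UNIV (\<lambda>x. INF y\<in>cball (0::real^'n) D. - sqrt (U (x + y) * U (x - y)))"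
    using assms(2) by (intro continuous_on_INF_compact) auto
  then show ?thesis unfolding midpoint_sup_def by (rule continuous_on_minus)
qed

lemma midpoint_sup_attained:
  fixes U :: "real^'n::finite \<Rightarrow> real"
  assumes "continuous_on UNIV U" "D \<ge> 0"
  obtains y where "norm y \<le> D" "midpoint_sup D U m = sqrt (U (m + y) * U (m - y))"
    "\<And>z. norm z \<le> D \<Longrightarrow> sqrt (U (m + z) * U (m - z)) \<le> midpoint_sup D U m"
proof -
  have "continuous_on (cball (0::real^'n) D) (\<lambda>y. - sqrt (U (m + y) * U (m - y)))"
    by (intro continuous_on_minus continuous_on_real_sqrt continuous_on_mult
        continuous_on_compose2[OF assms(1)] continuous_intros) auto
  then have "\<exists>y\<in>cball 0 D. (INF y\<in>cball 0 D. - sqrt (U (m + y) * U (m - y))) = - sqrt (U (m + y) * U (m - y)) \<and>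
      (\<forall>z\<in>cball 0 D. - sqrt (U (m + y) * U (m - y)) \<le> - sqrt (U (m + z) * U (m - z)))"
    using assms(2) by (intro compact_INF_attained) auto
  then obtain y where y: "y \<in> cball 0 D"
    "(INF y\<in>cball 0 D. - sqrt (U (m + y) * U (m - y))) = - sqrt (U (m + y) * U (m - y))"
    "\<forall>z\<in>cball 0 D. - sqrt (U (m + y) * U (m - y)) \<le> - sqrt (U (m + z) * U (m - z))" by blast
  show ?thesis
    by (rule that[of y]) (use y in \<open>auto simp: midpoint_sup_def\<close>)
qed

lemma sqrt_exp_mult: "sqrt (exp (- a) * exp (- b)) = exp (- (1/2) * (a + b))"
proof -
  have "exp (- a) * exp (- b) = (exp (- (1/2) * (a + b)))\<^sup>2"
    by (simp flip: exp_add exp_double add: algebra_simps)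
  then show ?thesis by (simp add: real_sqrt_unique)
qed

text \<open>With a maximizing \<open>y\<close> at \<open>m\<close> held fixed,
  \<open>sqrt (U (z + y) * U (z - y))\<close> as a function of \<open>z\<close> touches the supremum
  from below at \<open>m\<close>, and there satisfies the equation exactly.\<close>

lemma midpoint_sup_subsolution:
  fixes \<Omega> :: "(real^'n::finite) set" and U w :: "real^'n \<Rightarrow> real"
  assumes \<Omega>: "open \<Omega>" and R: "\<And>x. x \<in> \<Omega> \<Longrightarrow> norm x \<le> R" and D: "R < D"
    and U: "continuous_on UNIV U" "\<And>x. x \<in> \<Omega> \<Longrightarrow> U x = exp (- w x)" "\<And>x. x \<notin> \<Omega> \<Longrightarrow> U x = 0"
    and w: "smooth_on \<Omega> w"
    and eq: "\<And>x. x \<in> \<Omega> \<Longrightarrow> (\<Sum>i\<in>UNIV. partial_deriv i (partial_deriv i w) x) =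
      l + (\<Sum>i\<in>UNIV. x $ i * partial_deriv i w x) + (\<Sum>i\<in>UNIV. partial_deriv i w x * partial_deriv i w x)"
    and m: "m \<in> \<Omega>"
  shows "\<exists>Q a d. Q m = midpoint_sup D U m \<and> (\<forall>\<^sub>F z in nhds m. Q z \<le> midpoint_sup D U z) \<and>
      (\<forall>i. jet2 (\<lambda>t. Q (m + t *\<^sub>R axis i 1)) (a $ i) (d i)) \<and>
      (\<Sum>i\<in>UNIV. d i) - m \<bullet> a \<ge> - l * midpoint_sup D U m"
proof -
  have D0: "D \<ge> 0" using R[OF m] D norm_ge_zero[of m] by linarith
  obtain y where y: "norm y \<le> D" "midpoint_sup D U m = sqrt (U (m + y) * U (m - y))"
    "\<And>z. norm z \<le> D \<Longrightarrow> sqrt (U (m + z) * U (m - z)) \<le> midpoint_sup D U m"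
    using midpoint_sup_attained[OF U(1) D0] by blast
  \<comment> \<open>The parameter 0 already gives a positive value. Hence neither factor vanishes at
    the maximizing \<open>y\<close>, and both points lie in \<open>\<Omega>\<close>.\<close>
  have "0 < sqrt (U (m + 0) * U (m - 0))" using U(2)[OF m] by simp
  also have "\<dots> \<le> midpoint_sup D U m" using D0 by (intro y(3)) simp
  finally have "U (m + y) * U (m - y) \<noteq> 0" using y(2) by auto
  then have P: "m + y \<in> \<Omega>" and N: "m - y \<in> \<Omega>" using U(3) by force+
  \<comment> \<open>As half the difference of two points of \<open>\<Omega>\<close>,
    \<open>y\<close> has norm at most \<open>R < D\<close>. It is interior to the parameter ball and
    can be varied freely.\<close>
  have "norm ((m + y) - (m - y)) \<le> R + R"
    by (rule order_trans[OF norm_triangle_ineq4 add_mono[OF R[OF P] R[OF N]]])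
  moreover have "(m + y) - (m - y) = 2 *\<^sub>R y" by (simp add: scaleR_2)
  ultimately have yD: "norm y < D" using D by simp
  have sqrt_exp: "sqrt (U a * U b) = exp (- (1/2) * (w a + w b))" if "a \<in> \<Omega>" "b \<in> \<Omega>" for a b
    using U(2) that sqrt_exp_mult by simp
  have evP: "\<forall>\<^sub>F t in nhds 0. (m + y) + t *\<^sub>R axis i 1 \<in> \<Omega>" for i
    using eventually_nhds_line[OF eventually_nhds_in_open[OF \<Omega> P]] .
  have evN: "\<forall>\<^sub>F t in nhds 0. (m - y) + t *\<^sub>R axis i 1 \<in> \<Omega>" for i
    using eventually_nhds_line[OF eventually_nhds_in_open[OF \<Omega> N]] .
  have evN': "\<forall>\<^sub>F t in nhds 0. (m - y) + t *\<^sub>R - axis i 1 \<in> \<Omega>" for i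
    using eventually_nhds_line[OF eventually_nhds_in_open[OF \<Omega> N]] .
  note jP = smooth_on_jet2_axis[OF \<Omega> w P] and jN = smooth_on_jet2_axis[OF \<Omega> w N]
  \<comment> \<open>First-order condition in the parameter: varying \<open>y\<close> with
    \<open>m\<close> fixed moves the two points in opposite directions, so optimality equates the
    gradients.\<close>
  have grad: "partial_deriv i w (m + y) = partial_deriv i w (m - y)" for i
  proof -
    have "jet2 (\<lambda>t. w ((m + y) + t *\<^sub>R axis i 1) + w ((m - y) + (- t) *\<^sub>R axis i 1))
        (partial_deriv i w (m + y) + - partial_deriv i w (m - y))
        (partial_deriv i (partial_deriv i w) (m + y) + partial_deriv i (partial_deriv i w) (m - y))"
      using jet2_add[OF jP jet2_reflect[OF jN]] .
    moreover have "\<forall>\<^sub>F t in nhds 0. norm (y + t *\<^sub>R axis i 1) < D"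
      using eventually_nhds_line[OF eventually_nhds_in_open[of "ball 0 D" y]] yD by simp
    then have "\<forall>\<^sub>F t in nhds 0. w (m + y) + w (m - y) \<le>
        w ((m + y) + t *\<^sub>R axis i 1) + w ((m - y) + (- t) *\<^sub>R axis i 1)"
      using evP[of i] evN'[of i]
    proof eventually_elim
      case (elim t)
      have "sqrt (U (m + (y + t *\<^sub>R axis i 1)) * U (m - (y + t *\<^sub>R axis i 1))) \<le> sqrt (U (m + y) * U (m - y))"
        using y(3)[of "y + t *\<^sub>R axis i 1"] y(2) elim(1) by simp
      moreover have "m + (y + t *\<^sub>R axis i 1) = (m + y) + t *\<^sub>R axis i 1"
        "m - (y + t *\<^sub>R axis i 1) = (m - y) + (- t) *\<^sub>R axis i 1" by (simp_all add: algebra_simps)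
      ultimately show ?case using elim sqrt_exp P N by simp
    qed
    ultimately show ?thesis using jet2_local_min by fastforce
  qed
  define q where "q = sqrt (U (m + y) * U (m - y))"
  have q: "q = exp (- (1/2) * (w (m + y) + w (m - y)))" unfolding q_def by (rule sqrt_exp[OF P N])
  define a :: "real^'n" where "a = (\<chi> i. q * (- partial_deriv i w (m + y)))"
  define d where "d = (\<lambda>i. q * ((partial_deriv i w (m + y))\<^sup>2
      - (1/2) * (partial_deriv i (partial_deriv i w) (m + y) + partial_deriv i (partial_deriv i w) (m - y))))"
  \<comment> \<open>Now \<open>m\<close> varies with \<open>y\<close> fixed, so both points move in
    the same direction. The common gradient leaves its square in the second derivative of the
    exponential.\<close>
  have jet: "jet2 (\<lambda>t. sqrt (U ((m + t *\<^sub>R axis i 1) + y) * U ((m + t *\<^sub>R axis i 1) - y))) (a $ i) (d i)" for i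
  proof -
    have "jet2 (\<lambda>t. exp (- (1/2) * (w ((m + y) + t *\<^sub>R axis i 1) + w ((m - y) + t *\<^sub>R axis i 1)))) (a $ i) (d i)"
      using jet2_exp[OF jet2_cmult[where c="- (1/2)", OF jet2_add[OF jP[of i] jN[of i]]]]
      by (simp add: a_def d_def q grad power2_eq_square)
    moreover have "\<forall>\<^sub>F t in nhds 0. exp (- (1/2) * (w ((m + y) + t *\<^sub>R axis i 1) + w ((m - y) + t *\<^sub>R axis i 1)))
        = sqrt (U ((m + t *\<^sub>R axis i 1) + y) * U ((m + t *\<^sub>R axis i 1) - y))"
      using evP[of i] evN[of i]
    proof eventually_elim
      case (elim t)
      have line: "(m + t *\<^sub>R axis i 1) + y = (m + y) + t *\<^sub>R axis i 1"
        "(m + t *\<^sub>R axis i 1) - y = (m - y) + t *\<^sub>R axis i 1" by simp_all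
      show ?case unfolding line sqrt_exp[OF elim] ..
    qed
    ultimately show ?thesis by (rule jet2_cong)
  qed
  have "(\<Sum>i\<in>UNIV. d i) - m \<bullet> a = - l * q"
  proof -
    have "(\<Sum>i\<in>UNIV. d i) = q * ((\<Sum>i\<in>UNIV. (partial_deriv i w (m + y))\<^sup>2)
        - (1/2) * ((\<Sum>i\<in>UNIV. partial_deriv i (partial_deriv i w) (m + y))
          + (\<Sum>i\<in>UNIV. partial_deriv i (partial_deriv i w) (m - y))))"
      by (simp add: d_def sum_subtractf sum.distrib flip: sum_distrib_left sum_divide_distrib)
    \<comment> \<open>Both equations contain the same squared gradient, which cancels against the
      first sum. What remains is affine in the point, and averaging over \<open>m + y\<close> and
      \<open>m - y\<close> gives its value at \<open>m\<close>.\<close>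
    also have "\<dots> = q * (- l - (1/2) * ((\<Sum>i\<in>UNIV. (m + y) $ i * partial_deriv i w (m + y))
        + (\<Sum>i\<in>UNIV. (m - y) $ i * partial_deriv i w (m + y))))"
      unfolding eq[OF P] eq[OF N] grad[symmetric] by (simp add: power2_eq_square field_simps)
    also have "(\<Sum>i\<in>UNIV. (m + y) $ i * partial_deriv i w (m + y)) + (\<Sum>i\<in>UNIV. (m - y) $ i * partial_deriv i w (m + y))
        = 2 * (\<Sum>i\<in>UNIV. m $ i * partial_deriv i w (m + y))"
      by (simp add: sum_distrib_left algebra_simps flip: sum.distrib)
    finally have "(\<Sum>i\<in>UNIV. d i) = q * (- l) - q * (\<Sum>i\<in>UNIV. m $ i * partial_deriv i w (m + y))"
      by (simp add: algebra_simps)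
    moreover have "m \<bullet> a = - q * (\<Sum>i\<in>UNIV. m $ i * partial_deriv i w (m + y))"
      by (simp add: a_def inner_vec_def sum_distrib_left sum_negf mult_ac)
    ultimately show ?thesis by simp
  qed
  moreover have "sqrt (U (z + y) * U (z - y)) \<le> midpoint_sup D U z" for z
    using midpoint_sup_attained[OF U(1) D0, of z] y(1) by metis
  ultimately show ?thesis using jet y(2)
    by (intro exI[of _ "\<lambda>z. sqrt (U (z + y) * U (z - y))"] exI[of _ a] exI[of _ d]) (simp add: q_def)
qed

lemma continuous_extension_by_zero:
  fixes u :: "'a::topological_space \<Rightarrow> real"
  assumes "open S" "continuous_on (closure S) u" "\<And>x. x \<in> frontier S \<Longrightarrow> u x = 0"
  shows "continuous_on UNIV (\<lambda>x. if x \<in> S then u x else 0)"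
proof -
  have "continuous_on (closure S \<union> - S) (\<lambda>x. if x \<in> S then u x else 0)"
    by (rule continuous_on_If) (use assms in \<open>auto simp: frontier_def interior_open\<close>)
  moreover have "closure S \<union> - S = UNIV" using closure_subset by blast
  ultimately show ?thesis by simp
qed

text \<open>The maximum over the compact closure is positive, which places it in
  \<open>S\<close>.\<close>

lemma interior_maximum:
  fixes f :: "'a::heine_borel \<Rightarrow> real"
  assumes "bounded S" "continuous_on UNIV f" "\<And>x. x \<in> S \<Longrightarrow> f x > 0" "\<And>x. x \<notin> S \<Longrightarrow> f x = 0" "S \<noteq> {}"
  obtains x where "x \<in> S" "\<And>y. f y \<le> f x"
proof -
  have "compact (closure S)" using assms(1) by simp
  then obtain x where x: "x \<in> closure S" "\<forall>y\<in>closure S. f y \<le> f x"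
    using continuous_attains_sup[of "closure S" f] assms(5) continuous_on_subset[OF assms(2)] by auto
  obtain p where p: "p \<in> S" using assms(5) by blast
  then have "f x > 0" using x(2) assms(3)[OF p] closure_subset by force
  moreover from this have "x \<in> S" using assms(4) by force
  moreover have "f y \<le> f x" for y
    using x(2) assms(4)[of y] calculation(1) closure_subset[of S] by (cases "y \<in> S") auto
  ultimately show ?thesis using that by blast
qed

section \<open>Log-concavity\<close>

lemma positive_solution_log_concave:
  fixes \<Omega> :: "(real^'n::finite) set" and u :: "real^'n \<Rightarrow> real"
  assumes \<Omega>: "open \<Omega>" "bounded \<Omega>" "convex \<Omega>" "\<Omega> \<noteq> {}"
    and u: "smooth_on \<Omega> u" "continuous_on UNIV U" "\<And>x. x \<in> \<Omega> \<Longrightarrow> U x = u x" "\<And>x. x \<notin> \<Omega> \<Longrightarrow> U x = 0"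
    and upos: "\<And>x. x \<in> \<Omega> \<Longrightarrow> u x > 0"
    and eq: "\<And>x. x \<in> \<Omega> \<Longrightarrow> - laplacian u x + x \<bullet> gradient u x = l * u x"
    and x: "x \<in> \<Omega>"
  shows "0 \<le> v \<bullet> (hessian (\<lambda>y. - ln (u y)) x *v v)"
proof -
  define w where "w = (\<lambda>y. - ln (u y))"
  have w: "smooth_on \<Omega> w" unfolding w_def by (rule smooth_on_minus_ln[OF \<Omega>(1) u(1) upos])
  have Uw: "U y = exp (- w y)" if "y \<in> \<Omega>" for y using u(3) upos that by (simp add: w_def)
  have Upos: "U y > 0" if "y \<in> \<Omega>" for y using u(3) upos that by simp
  have Unn: "U y \<ge> 0" for y using Upos[of y] u(4)[of y] by (cases "y \<in> \<Omega>") auto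
  obtain R where R: "R > 0" "\<And>x. x \<in> \<Omega> \<Longrightarrow> norm x \<le> R"
    using \<Omega>(2) unfolding bounded_pos by blast
  define D where "D = R + 1"
  have D: "D \<ge> 0" "D > 0" "R < D" using R(1) by (auto simp: D_def)
  let ?V = "midpoint_sup D U"
  \<comment> \<open>By convexity, \<open>m + y\<close> and \<open>m - y\<close> cannot both lie in
    \<open>\<Omega>\<close> when their midpoint \<open>m\<close> does not; so one factor is
    0.\<close>
  have Vout: "?V m = 0" if m: "m \<notin> \<Omega>" for m
  proof -
    obtain y where y: "?V m = sqrt (U (m + y) * U (m - y))"
      using midpoint_sup_attained[OF u(2) D(1)] by blast
    have "\<not> (m + y \<in> \<Omega> \<and> m - y \<in> \<Omega>)"
    proof
      assume "m + y \<in> \<Omega> \<and> m - y \<in> \<Omega>"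
      then have "(1/2) *\<^sub>R (m + y) + (1/2) *\<^sub>R (m - y) \<in> \<Omega>"
        using \<Omega>(3) by (intro convexD) auto
      moreover have "(1/2) *\<^sub>R (m + y) + (1/2) *\<^sub>R (m - y) = m"
        by (simp add: algebra_simps flip: scaleR_add_left)
      ultimately show False using m by simp
    qed
    then show ?thesis using y u(4) by auto
  qed
  have weq: "(\<Sum>i\<in>UNIV. partial_deriv i (partial_deriv i w) y) =
      l + (\<Sum>i\<in>UNIV. y $ i * partial_deriv i w y) + (\<Sum>i\<in>UNIV. partial_deriv i w y * partial_deriv i w y)"
    if "y \<in> \<Omega>" for y
    by (rule neg_log_equation[OF \<Omega>(1) u(1) that upos eq[OF that] w_def])
  have "\<exists>C. \<forall>y\<in>\<Omega>. ?V y = C * u y"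
    using subsolution_eq_multiple[OF \<Omega> u upos eq midpoint_sup_continuous[OF u(2) D(1)] Vout
        midpoint_sup_subsolution[OF \<Omega>(1) R(2) D(3) u(2) Uw u(4) w weq]] .
  then obtain C where C: "\<And>y. y \<in> \<Omega> \<Longrightarrow> ?V y = C * u y" by blast
  \<comment> \<open>At a global maximum point of \<open>U\<close> no pair of values exceeds
    \<open>U p\<close> in geometric mean, so the supremum equals \<open>U p\<close> there. This
    fixes \<open>C = 1\<close>.\<close>
  obtain p where p: "p \<in> \<Omega>" "\<And>y. U y \<le> U p"
    using interior_maximum[OF \<Omega>(2) u(2) Upos u(4) \<Omega>(4)] by blast
  obtain y where y: "?V p = sqrt (U (p + y) * U (p - y))"
      "\<And>z. norm z \<le> D \<Longrightarrow> sqrt (U (p + z) * U (p - z)) \<le> ?V p"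
    using midpoint_sup_attained[OF u(2) D(1)] by blast
  have "?V p \<le> sqrt (U p * U p)"
    unfolding y(1) using p(2) Unn by (intro real_sqrt_le_mono mult_mono) auto
  moreover have "U p \<le> ?V p" using y(2)[of 0] D(1) Unn[of p] by simp
  ultimately have "?V p = U p" using Unn[of p] by simp
  then have "C = 1" using C[OF p(1)] u(3)[OF p(1)] upos[OF p(1)] by simp
  then have V: "?V x = exp (- w x)" using C[OF x] u(3)[OF x] Uw[OF x] by simp
  \<comment> \<open>Equality of the supremum and \<open>U\<close> at \<open>x\<close> says that
    \<open>w (x + t *\<^sub>R v) + w (x - t *\<^sub>R v)\<close> is minimal at \<open>t = 0\<close>.
    Its second derivative there is twice the Hessian form.\<close>
  note j = smooth_on_jet2_hessian[OF \<Omega>(1) w x, of v]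
  have "\<forall>\<^sub>F t in nhds 0. w (x + 0 *\<^sub>R v) + w (x + (- 0) *\<^sub>R v) \<le> w (x + t *\<^sub>R v) + w (x + (- t) *\<^sub>R v)"
  proof -
    have "\<forall>\<^sub>F t in nhds 0. x + t *\<^sub>R v \<in> \<Omega>" "\<forall>\<^sub>F t in nhds 0. x + t *\<^sub>R (- v) \<in> \<Omega>"
      using eventually_nhds_line[OF eventually_nhds_in_open[OF \<Omega>(1) x]] by blast+
    moreover have "\<forall>\<^sub>F t in nhds 0. norm (0 + t *\<^sub>R v) < D"
      using eventually_nhds_line[OF eventually_nhds_in_open[of "ball 0 D" 0]] D(2) by simp
    ultimately show ?thesis
    proof eventually_elim
      case (elim t)
      have "sqrt (U (x + t *\<^sub>R v) * U (x - t *\<^sub>R v)) \<le> ?V x"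
        using midpoint_sup_attained[OF u(2) D(1), of x] elim(3) by (metis add_0 less_imp_le)
      then show ?case
        using elim Uw V sqrt_exp_mult by simp
    qed
  qed
  then have "0 \<le> v \<bullet> (hessian w x *v v) + v \<bullet> (hessian w x *v v)"
    using jet2_local_min[OF jet2_add[OF j jet2_reflect[OF j]]] by simp
  then show ?thesis by (simp add: w_def)
qed

section \<open>Strong convexity of the negative logarithm\<close>

theorem theorem1p1:
  fixes \<Omega> :: "(real^'n::finite) set" and u :: "real^'n \<Rightarrow> real"
  assumes "open \<Omega>" and "bounded \<Omega>" and "convex \<Omega>"
    and "smooth_on \<Omega> u" and "continuous_on (closure \<Omega>) u"
    and "\<And>x. x \<in> \<Omega> \<Longrightarrow> u x > 0"
    and "\<And>x. x \<in> \<Omega> \<Longrightarrow> - laplacian u x + x \<bullet> gradient u x = gauss_frequency \<Omega> * u x"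
    and "\<And>x. x \<in> frontier \<Omega> \<Longrightarrow> u x = 0"
  shows "\<forall>x\<in>\<Omega>. positive_definite (hessian (\<lambda>y. - ln (u y)) x)"
proof
  fix x assume x: "x \<in> \<Omega>"
  then have ne: "\<Omega> \<noteq> {}" by blast
  note upos = assms(6) and eq = assms(7)
  define w where "w = (\<lambda>y. - ln (u y))"
  have w: "smooth_on \<Omega> w" unfolding w_def by (rule smooth_on_minus_ln[OF assms(1,4) upos])
  define U where "U = (\<lambda>x. if x \<in> \<Omega> then u x else 0)"
  have U: "continuous_on UNIV U" "\<And>x. x \<in> \<Omega> \<Longrightarrow> U x = u x" "\<And>x. x \<notin> \<Omega> \<Longrightarrow> U x = 0"
    using continuous_extension_by_zero[OF assms(1,5,8)] by (auto simp: U_def)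
  have psd: "0 \<le> v \<bullet> (hessian w y *v v)" if "y \<in> \<Omega>" for y v
    unfolding w_def by (rule positive_solution_log_concave[OF assms(1-3) ne assms(4) U upos eq that])
  \<comment> \<open>A maximum of this product is a minimum of \<open>w - x \<bullet> x\<close>; it
    is interior because \<open>U\<close> vanishes off \<open>\<Omega>\<close>. There the Hessian
    form of \<open>w\<close> is at least \<open>2 * (v \<bullet> v)\<close>, which supplies the
    point of strict positivity.\<close>
  have "continuous_on UNIV (\<lambda>x. U x * exp (x \<bullet> x))"
    by (intro continuous_on_mult U(1) continuous_intros)
  then obtain p where p: "p \<in> \<Omega>" "\<And>y. U y * exp (y \<bullet> y) \<le> U p * exp (p \<bullet> p)"
    by (rule interior_maximum[OF assms(2)]) (use U upos ne in auto)
  have pd: "0 < v \<bullet> (hessian w p *v v)" if "v \<noteq> 0" for v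
  proof -
    have "\<forall>\<^sub>F t in nhds 0. w (p + 0 *\<^sub>R v) - (p + 0 *\<^sub>R v) \<bullet> (p + 0 *\<^sub>R v)
        \<le> w (p + t *\<^sub>R v) - (p + t *\<^sub>R v) \<bullet> (p + t *\<^sub>R v)"
      using eventually_nhds_line[OF eventually_nhds_in_open[OF assms(1) p(1)], of v]
    proof eventually_elim
      case (elim t)
      have "exp (- w (p + t *\<^sub>R v)) * exp ((p + t *\<^sub>R v) \<bullet> (p + t *\<^sub>R v)) \<le> exp (- w p) * exp (p \<bullet> p)"
        using p(2)[of "p + t *\<^sub>R v"] U(2) upos elim p(1) by (simp add: w_def)
      then show ?case by (simp flip: exp_add)
    qed
    moreover have "(p + t *\<^sub>R v) \<bullet> (p + t *\<^sub>R v) = p \<bullet> p + 2 * (p \<bullet> v) * t + (v \<bullet> v) * t\<^sup>2" for t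
      by (simp add: inner_add_left inner_add_right inner_commute power2_eq_square algebra_simps)
    then have "jet2 (\<lambda>t. (p + t *\<^sub>R v) \<bullet> (p + t *\<^sub>R v)) (2 * (p \<bullet> v)) (2 * (v \<bullet> v))"
      by (simp only: jet2_quadratic)
    ultimately have "v \<bullet> (hessian w p *v v) - 2 * (v \<bullet> v) \<ge> 0"
      using jet2_local_min[OF jet2_diff[OF smooth_on_jet2_hessian[OF assms(1) w p(1)]]] by blast
    moreover have "v \<bullet> v > 0" using that by simp
    ultimately show ?thesis by linarith
  qed
  have "0 < v \<bullet> (hessian w x *v v)" if "v \<noteq> 0" for v
    by (rule nonneg_hessian_imp_positive[OF assms(1) convex_connected[OF assms(3)] w
          neg_log_equation[OF assms(1,4) _ upos eq w_def] psd p(1) pd x that])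
  then show "positive_definite (hessian (\<lambda>y. - ln (u y)) x)"
    using transpose_hessian[OF assms(1) w x] by (simp add: positive_definite_def w_def)
qed

end
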